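(* Let $A$ be an invariant algebra on a compact Hausdorff group $G$, $H$ a closed subgroup of $G$, $M=H\backslash G$ the right homogeneous space, and $A^H=L_HA$. Then the action of $G$ on $M$ extends to a (right) action of the semigroup $\mathcal{M}_A$ on $\mathcal{M}_{A^H}$ by $$f(\psi\varphi)=(R_\varphi f)(\psi)\qquad\text{for all } f\in A^H,\ \psi\in\mathcal{M}_{A^H},\ \varphi\in\mathcal{M}_A,$$ where the right-hand side defines the left-hand side. For each $p\in M$, $$p\,\mathcal{M}_A=\mathcal{M}_{A^H}.$$
   Context: $C(G)$ is the Banach algebra of continuous complex functions on $G$ with the sup-norm; $L_gf(h)=f(gh)$, $R_gf(h)=f(hg)$. An invariant algebra on $G$ is a closed subalgebra $A\subseteq C(G)$ that contains the constants and satisfies $L_gA\subseteq A$, $R_gA\subseteq A$ for all $g\in G$. For a commutative Banach algebra $B$ with identity, $\mathcal{M}_B$ is the set of all nonzero multiplicative linear functionals on $B$ with the weak-* topology; elements $f\in B$ are regarded as functions on $\mathcal{M}_B$ by $f(\psi)=\psi(f)$. $\mathcal{M}_A$ is a semigroup under convolution: $(\varphi\psi)(f)=\int_{G\times G}f(gh)\,d\mu(g)\,d\nu(h)$ for any finite regular Borel complex measures $\mu,\nu$ on $G$ extending $\varphi,\psi$ to $C(G)$ (independent of the choice). The group $G$ maps to $\mathcal{M}_A$ by $g\mapsto\mathrm{ev}_g$, $\mathrm{ev}_g(f)=f(g)$. For $\varphi\in\mathcal{M}_A$, $R_\varphi:A\to A$ is given by $R_\varphi f(g)=\varphi(L_gf)$;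 it commutes with left translations. $L_H=\int_HL_h\,dh$ ($dh$ the normalized Haar measure of $H$) is the left averaging operator over $H$; $A^H=L_HA$ is the closed right-invariant subalgebra of left $H$-invariant functions in $A$, regarded as a subalgebra of $C(G)$ and also of $C(M)$. A point $p\in M$ is identified with the evaluation functional at $p$ in $\mathcal{M}_{A^H}$. *)

theory Defs
  imports "HOL-Analysis.Analysis"
begin

text \<open>
  The group operation is written additively, since the library's class of topological groups is
  \<^class>\<open>topological_group_add\<close>; it is not assumed to be commutative, so the order of summands
  matters throughout. Compactness of the whole group is a separate assumption where it is needed.
\<close>

subsection \<open>Invariant algebras and characters\<close>

definition left_translate :: "'g::plus \<Rightarrow> ('g \<Rightarrow> complex) \<Rightarrow> 'g \<Rightarrow> complex" where
  "left_translate g f = (\<lambda>h. f (g + h))"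

definition right_translate :: "'g::plus \<Rightarrow> ('g \<Rightarrow> complex) \<Rightarrow> 'g \<Rightarrow> complex" where
  "right_translate g f = (\<lambda>h. f (h + g))"

text \<open>
  On a compact group every continuous function is bounded, and convergence in the sup-norm is
  uniform convergence; closedness in the sup-norm is therefore sequential closedness under
  uniform limits.
\<close>

definition closed_unital_subalgebra :: "('g::topological_space \<Rightarrow> complex) set \<Rightarrow> bool" where
  "closed_unital_subalgebra A \<longleftrightarrow>
     (\<forall>f\<in>A. continuous_on UNIV f) \<and>
     (\<forall>c. (\<lambda>x. c) \<in> A) \<and>
     (\<forall>f\<in>A. \<forall>g\<in>A. (\<lambda>x. f x + g x) \<in> A) \<and>
     (\<forall>f\<in>A. \<forall>g\<in>A. (\<lambda>x. f x * g x) \<in> A) \<and>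
     (\<forall>c. \<forall>f\<in>A. (\<lambda>x. c * f x) \<in> A) \<and>
     (\<forall>F f. (\<forall>n. F n \<in> A) \<and> uniform_limit UNIV F f sequentially \<longrightarrow> f \<in> A)"

definition invariant_algebra :: "('g::topological_group_add \<Rightarrow> complex) set \<Rightarrow> bool" where
  "invariant_algebra A \<longleftrightarrow>
     closed_unital_subalgebra A \<and>
     (\<forall>g. left_translate g ` A \<subseteq> A) \<and> (\<forall>g. right_translate g ` A \<subseteq> A)"

text \<open>
  The set of nonzero multiplicative linear functionals on an algebra \<open>B\<close> of functions. A functional
  on \<open>B\<close> is a function that is \<^const>\<open>undefined\<close> outside \<open>B\<close>, so that equality of functionals is
  equality on \<open>B\<close>.
\<close>

definition spectrum :: "('g \<Rightarrow> complex) set \<Rightarrow> (('g \<Rightarrow> complex) \<Rightarrow> complex) set" where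
  "spectrum B = {\<phi> \<in> extensional B.
     (\<forall>f\<in>B. \<forall>g\<in>B. \<phi> (\<lambda>x. f x + g x) = \<phi> f + \<phi> g) \<and>
     (\<forall>c. \<forall>f\<in>B. \<phi> (\<lambda>x. c * f x) = c * \<phi> f) \<and>
     (\<forall>f\<in>B. \<forall>g\<in>B. \<phi> (\<lambda>x. f x * g x) = \<phi> f * \<phi> g) \<and>
     (\<exists>f\<in>B. \<phi> f \<noteq> 0)}"

definition evaluation :: "('g \<Rightarrow> complex) set \<Rightarrow> 'g \<Rightarrow> ('g \<Rightarrow> complex) \<Rightarrow> complex" where
  "evaluation B g = (\<lambda>f\<in>B. f g)"


subsection \<open>Measures\<close>

text \<open>Finite positive regular Borel measures on the subspace \<open>S\<close>.\<close>

definition regular_borel_measure_on :: "'g::topological_space set \<Rightarrow> 'g measure \<Rightarrow> bool" where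
  "regular_borel_measure_on S m \<longleftrightarrow>
     sets m = sets (restrict_space borel S) \<and> finite_measure m \<and>
     (\<forall>E\<in>sets m.
        emeasure m E = (SUP K\<in>{K. compact K \<and> K \<subseteq> E}. emeasure m K) \<and>
        emeasure m E = (INF U\<in>{U. openin (top_of_set S) U \<and> E \<subseteq> U}. emeasure m U))"

text \<open>
  A finite regular Borel complex measure \<open>\<mu>\<close> is given by its polar decomposition \<open>d\<mu> = k d|\<mu>|\<close>:
  the pair of its total variation, which is a finite positive regular Borel measure, and a Borel
  function \<open>k\<close> of modulus one. Every such pair is the polar decomposition of a complex measure.
\<close>

type_synonym 'g polar_measure = "'g measure \<times> ('g \<Rightarrow> complex)"

definition complex_regular_borel_measure :: "'g::topological_space polar_measure \<Rightarrow> bool" where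
  "complex_regular_borel_measure \<mu> \<longleftrightarrow>
     regular_borel_measure_on UNIV (fst \<mu>) \<and>
     snd \<mu> \<in> borel_measurable borel \<and> (\<forall>x. norm (snd \<mu> x) = 1)"

definition complex_integral :: "'g::topological_space polar_measure \<Rightarrow> ('g \<Rightarrow> complex) \<Rightarrow> complex" where
  "complex_integral \<mu> f = (\<integral>x. f x * snd \<mu> x \<partial>fst \<mu>)"

definition extends_functional ::
  "('g::topological_space \<Rightarrow> complex) set \<Rightarrow> 'g polar_measure \<Rightarrow> (('g \<Rightarrow> complex) \<Rightarrow> complex) \<Rightarrow> bool" where
  "extends_functional A \<mu> \<phi> \<longleftrightarrow>
     complex_regular_borel_measure \<mu> \<and> (\<forall>f\<in>A. complex_integral \<mu> f = \<phi> f)"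

text \<open>
  The description determines a unique functional because the double integral does not depend on
  the choice of the extending measures \<open>\<mu>\<close> and \<open>\<nu>\<close>.
\<close>

definition convolution ::
  "('g::topological_group_add \<Rightarrow> complex) set \<Rightarrow> (('g \<Rightarrow> complex) \<Rightarrow> complex) \<Rightarrow>
     (('g \<Rightarrow> complex) \<Rightarrow> complex) \<Rightarrow> ('g \<Rightarrow> complex) \<Rightarrow> complex" where
  "convolution A \<phi> \<psi> =
     (THE \<eta>. \<exists>\<mu> \<nu>. extends_functional A \<mu> \<phi> \<and> extends_functional A \<nu> \<psi> \<and>
        \<eta> = (\<lambda>f\<in>A. complex_integral \<nu> (\<lambda>h. complex_integral \<mu> (\<lambda>g. f (g + h)))))"


subsection \<open>Homogeneous spaces and averaging\<close>

definition closed_subgroup :: "'g::topological_group_add set \<Rightarrow> bool" where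
  "closed_subgroup H \<longleftrightarrow>
     closed H \<and> 0 \<in> H \<and> (\<forall>x\<in>H. \<forall>y\<in>H. x + y \<in> H) \<and> (\<forall>x\<in>H. - x \<in> H)"

definition right_cosets :: "'g::plus set \<Rightarrow> 'g set set" where
  "right_cosets H = range (\<lambda>g. (\<lambda>h. h + g) ` H)"

definition coset_translate :: "'g::plus set \<Rightarrow> 'g \<Rightarrow> 'g set" where
  "coset_translate p g = (\<lambda>x. x + g) ` p"

definition normalized_haar_measure :: "'g::topological_group_add set \<Rightarrow> 'g measure \<Rightarrow> bool" where
  "normalized_haar_measure H m \<longleftrightarrow>
     regular_borel_measure_on H m \<and> emeasure m H = 1 \<and>
     (\<forall>h\<in>H. \<forall>E\<in>sets m. emeasure m ((\<lambda>x. h + x) ` E) = emeasure m E)"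

text \<open>
  The average of the translates \<open>left_translate h f\<close> over \<open>h \<in> H\<close>; the underlying space of the
  measure \<open>m\<close> is \<open>H\<close>.
\<close>

definition left_average :: "'g::topological_group_add measure \<Rightarrow> ('g \<Rightarrow> complex) \<Rightarrow> 'g \<Rightarrow> complex" where
  "left_average m f = (\<lambda>g. \<integral>h. left_translate h f g \<partial>m)"

text \<open>
  Evaluation at a point \<open>p\<close> of the coset space: a left \<open>H\<close>-invariant function \<open>f\<close> is constant on
  the coset \<open>p\<close>, so \<open>f ` p\<close> is a singleton.
\<close>

definition coset_evaluation :: "('g \<Rightarrow> complex) set \<Rightarrow> 'g set \<Rightarrow> ('g \<Rightarrow> complex) \<Rightarrow> complex" where
  "coset_evaluation B p = (\<lambda>f\<in>B. the_elem (f ` p))"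


subsection \<open>The action\<close>

definition right_operator ::
  "(('g::plus \<Rightarrow> complex) \<Rightarrow> complex) \<Rightarrow> ('g \<Rightarrow> complex) \<Rightarrow> 'g \<Rightarrow> complex" where
  "right_operator \<phi> f = (\<lambda>g. \<phi> (left_translate g f))"

definition spectrum_action ::
  "('g::plus \<Rightarrow> complex) set \<Rightarrow> (('g \<Rightarrow> complex) \<Rightarrow> complex) \<Rightarrow> (('g \<Rightarrow> complex) \<Rightarrow> complex) \<Rightarrow>
     ('g \<Rightarrow> complex) \<Rightarrow> complex" where
  "spectrum_action B \<psi> \<phi> = (\<lambda>f\<in>B. \<psi> (right_operator \<phi> f))"

definition right_semigroup_action ::
  "'s set \<Rightarrow> ('s \<Rightarrow> 's \<Rightarrow> 's) \<Rightarrow> 's \<Rightarrow> 'x set \<Rightarrow> ('x \<Rightarrow> 's \<Rightarrow> 'x) \<Rightarrow> bool" where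
  "right_semigroup_action S prd e X act \<longleftrightarrow>
     (\<forall>x\<in>X. \<forall>s\<in>S. act x s \<in> X) \<and>
     (\<forall>x\<in>X. \<forall>s\<in>S. \<forall>t\<in>S. act (act x s) t = act x (prd s t)) \<and>
     (\<forall>x\<in>X. act x e = x)"

end

theory Submission
  imports Defs "HOL-Complex_Analysis.Cauchy_Integral_Formula"
begin

text \<open>
  A character \<open>\<phi>\<close> of \<open>A\<close> satisfies \<open>Re (\<phi> f) \<le> sup Re f\<close>, so the Hahn--Banach and Riesz
  theorems represent it by a regular Borel probability measure \<open>\<mu>\<close>. Hence \<open>R\<^sub>\<phi> f\<close> is a uniform
  limit of combinations of right translates of \<open>f\<close> and lies in \<open>A\<close>; it inherits left
  \<open>H\<close>-invariance from \<open>f\<close>. The action law is an exchange of two integrals.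

  Transitivity reduces to extending a character \<open>\<psi>\<close> of \<open>A\<^sup>H\<close> to \<open>A\<close>, since \<open>p \<phi>\<close> for \<open>p = H k\<close> is
  the restriction to \<open>A\<^sup>H\<close> of a left translate of \<open>\<phi>\<close>. Averaging over \<open>H\<close> is a projection of \<open>A\<close>
  onto \<open>A\<^sup>H\<close> that is linear over \<open>A\<^sup>H\<close>. Therefore the kernel of \<open>\<psi>\<close> lies in a proper ideal
  of \<open>A\<close>, and the quotient by a maximal ideal above it is the complex field by Gelfand--Mazur.
\<close>

subsection \<open>The Hahn--Banach theorem\<close>

text \<open>Only real parts are represented by a measure: a functional dominated by the supremum is
  automatically positive, so the Riesz theorem for positive functionals suffices although
  convolution is defined through complex measures. The choice of extending measures is immaterial
  because the inner integral is again a member of \<open>A\<close>, on which the outer measure acts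
  as the character. In the extension step the ideal is the largest one inside the kernel of the
  composite of \<open>\<psi>\<close> with averaging. It is proper because the average of 1 is 1, and
  it contains the kernel of \<open>\<psi>\<close> because elements of the invariant subalgebra come
  out of the average. The definition of Haar measure provides left invariance only, whereas left
  \<open>H\<close>-invariance of an average is a right translation under the integral sign.
  Invariance under inversion on \<open>H\<close> bridges the gap. The group may be nonmetrizable, so
  exchanges of integrals go through finite sums whose weights serve a whole family of integrands at
  once.\<close>

definition sublinear :: "('a::real_vector \<Rightarrow> real) \<Rightarrow> bool" where
  "sublinear p \<longleftrightarrow> (\<forall>x y. p (x + y) \<le> p x + p y) \<and> (\<forall>c>0. \<forall>x. p (c *\<^sub>R x) \<le> c * p x)"

lemma sublinearI:
  assumes "\<And>x y. p (x + y) \<le> p x + p y" "\<And>c x. 0 < c \<Longrightarrow> p (c *\<^sub>R x) \<le> c * p x"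
  shows "sublinear p"
  using assms by (auto simp: sublinear_def)

lemma sublinear_add: "sublinear p \<Longrightarrow> p (x + y) \<le> p x + p y"
  by (auto simp: sublinear_def)

text \<open>The definition asks only for an inequality at positive scalars, which is easy to check
  for infima. Applying it to \<open>inverse c\<close> reverses it, and the case \<open>c = 2\<close>
  at the origin forces \<open>p 0 = 0\<close>.\<close>

lemma sublinear_scaleR:
  assumes "sublinear p" "0 \<le> c"
  shows "p (c *\<^sub>R x) = c * p x"
proof -
  have le: "p (c *\<^sub>R x) \<le> c * p x" if "c > 0" for c x
    using assms that by (auto simp: sublinear_def)
  have pos: "p (c *\<^sub>R x) = c * p x" if "c > 0" for c x
    using le[of c x] le[of "inverse c" "c *\<^sub>R x"] that
    by (simp add: field_simps)
  have "p 0 = 0"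
    using pos[of 2 0] by simp
  then show ?thesis
    using pos[of c x] assms by (cases "c = 0") auto
qed

lemma sublinear_0: "sublinear p \<Longrightarrow> p 0 = 0"
  using sublinear_scaleR[of p 0 0] by simp

lemma sublinear_minus: "sublinear p \<Longrightarrow> - p (- x) \<le> p x"
  using sublinear_add[of p x "- x"] sublinear_0[of p] by simp

text \<open>The Hahn-Banach theorem is obtained from minimality: the linear functionals are found as
  the minimal sublinear ones. A chain has its pointwise infimum as a bound, which is finite because
  every member satisfies \<open>- p (- x) \<le> q x\<close>.\<close>

lemma sublinear_minimal_below:
  assumes p: "sublinear (p :: 'a::real_vector \<Rightarrow> real)"
  obtains q where "sublinear q" "\<And>x. q x \<le> p x"
    "\<forall>r. sublinear r \<longrightarrow> (\<forall>x. r x \<le> q x) \<longrightarrow> r = q"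
proof -
  define S where "S = {q. sublinear q \<and> (\<forall>x. q x \<le> p x)}"
  \<comment> \<open>The pointwise order is reversed, so that the maximal element given by Zorn's
    lemma is a minimal function.\<close>
  define P where "P = (\<lambda>(f::'a \<Rightarrow> real) g. \<forall>x. g x \<le> f x)"
  have po: "partial_order_on S (relation_of P S)"
    by (auto simp: partial_order_on_def preorder_on_def relation_of_def P_def
        intro!: refl_onI transI antisymI order.antisym ext intro: order_trans)
  have "\<exists>m\<in>S. \<forall>a\<in>S. P m a \<longrightarrow> a = m"
  proof (rule predicate_Zorn[OF po])
    fix C assume C: "C \<in> Chains (relation_of P S)"
    then have CS: "C \<subseteq> S" and ch: "\<And>f g. f \<in> C \<Longrightarrow> g \<in> C \<Longrightarrow> P f g \<or> P g f"
      by (auto simp: Chains_def relation_of_def)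
    show "\<exists>u\<in>S. \<forall>a\<in>C. P a u"
    proof (cases "C = {}")
      case True
      then show ?thesis using p by (auto simp: S_def)
    next
      case False
      define u where "u x = (INF q\<in>C. q x)" for x
      have bdd: "bdd_below ((\<lambda>q. q x) ` C)" for x
      proof (rule bdd_belowI2)
        fix q assume "q \<in> C"
        then have "sublinear q" "q (- x) \<le> p (- x)" using CS by (auto simp: S_def)
        then show "- p (- x) \<le> q x" using sublinear_minus[of q x] by simp
      qed
      have lower: "u x \<le> q x" if "q \<in> C" for q x
        unfolding u_def by (rule cINF_lower[OF bdd that])
      have greatest: "z \<le> u x" if "\<And>q. q \<in> C \<Longrightarrow> z \<le> q x" for z x
        unfolding u_def using False that by (rule cINF_greatest)
      have "sublinear u"
      proof (rule sublinearI)
        fix x y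
        have "u (x + y) - q x \<le> r y" if qr: "q \<in> C" "r \<in> C" for q r
        proof -
          \<comment> \<open>The smaller of \<open>q\<close> and \<open>r\<close> in the chain serves
            both arguments at once.\<close>
          obtain s where s: "s \<in> C" "s x \<le> q x" "s y \<le> r y"
            using ch[OF qr] qr by (auto simp: P_def)
          have "u (x + y) \<le> s x + s y"
            using lower[OF s(1), of "x + y"] s(1) CS sublinear_add[of s x y] by (force simp: S_def)
          then show ?thesis using s by simp
        qed
        then have "u (x + y) - q x \<le> u y" if "q \<in> C" for q
          using that by (intro greatest) auto
        then have "u (x + y) - u y \<le> u x"
          by (intro greatest) (simp add: algebra_simps)
        then show "u (x + y) \<le> u x + u y" by simp
      next
        fix c :: real and x assume c: "c > 0"
        have "u (c *\<^sub>R x) / c \<le> u x"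
        proof (rule greatest)
          fix q assume q: "q \<in> C"
          then have "q (c *\<^sub>R x) = c * q x"
            using CS c by (intro sublinear_scaleR) (auto simp: S_def)
          then show "u (c *\<^sub>R x) / c \<le> q x"
            using lower[OF q, of "c *\<^sub>R x"] c by (simp add: field_simps)
        qed
        then show "u (c *\<^sub>R x) \<le> c * u x" using c by (simp add: field_simps)
      qed
      moreover have "u x \<le> p x" for x
      proof -
        obtain q where "q \<in> C" using False by auto
        moreover from this have "q x \<le> p x" using CS by (auto simp: S_def)
        ultimately show ?thesis using lower[of q x] by simp
      qed
      ultimately show ?thesis
        using lower by (intro bexI[of _ u]) (auto simp: S_def P_def)
    qed
  qed
  then obtain q where q: "q \<in> S" "\<And>a. a \<in> S \<Longrightarrow> P q a \<Longrightarrow> a = q" by blast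
  show thesis
  proof (rule that[of q])
    show "sublinear q" "\<And>x. q x \<le> p x" using q by (auto simp: S_def)
    show "\<forall>r. sublinear r \<longrightarrow> (\<forall>x. r x \<le> q x) \<longrightarrow> r = q"
    proof (intro allI impI)
      fix r assume "sublinear r" "\<forall>x. r x \<le> q x"
      then show "r = q"
        using q(1) by (intro q(2)) (auto simp: S_def P_def intro: order_trans)
    qed
  qed
qed

text \<open>For fixed \<open>y\<close>, the infimum of
  \<open>q (x + t *\<^sub>R y) - t * q y\<close> over \<open>t \<ge> 0\<close> is sublinear in
  \<open>x\<close> and lies below \<open>q\<close> (take \<open>t = 0\<close>). By minimality it is
  \<open>q\<close>, and \<open>t = 1\<close> then gives superadditivity.\<close>

lemma minimal_sublinear_imp_linear:
  assumes q: "sublinear q" and min: "\<And>r. sublinear r \<Longrightarrow> (\<And>x. r x \<le> q x) \<Longrightarrow> r = q"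
  shows "linear q"
proof -
  have super: "q x + q y \<le> q (x + y)" for x y
  proof -
    define r where "r x = (INF t\<in>{0..}. q (x + t *\<^sub>R y) - t * q y)" for x
    have bdd: "bdd_below ((\<lambda>t. q (x + t *\<^sub>R y) - t * q y) ` {0..})" for x
    proof (rule bdd_belowI2)
      fix t :: real assume "t \<in> {0..}"
      then show "- q (- x) \<le> q (x + t *\<^sub>R y) - t * q y"
        using sublinear_add[OF q, of "x + t *\<^sub>R y" "- x"] sublinear_scaleR[OF q, of t y] by simp
    qed
    have lower: "r x \<le> q (x + t *\<^sub>R y) - t * q y" if "t \<ge> 0" for x t
      unfolding r_def using that by (intro cINF_lower[OF bdd]) auto
    have greatest: "z \<le> r x" if "\<And>t. t \<ge> 0 \<Longrightarrow> z \<le> q (x + t *\<^sub>R y) - t * q y" for z x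
      unfolding r_def using that by (intro cINF_greatest) auto
    have "sublinear r"
    proof (rule sublinearI)
      fix a b
      have "r (a + b) - (q (a + s *\<^sub>R y) - s * q y) \<le> q (b + t *\<^sub>R y) - t * q y"
        if "s \<ge> 0" "t \<ge> 0" for s t
        using lower[of "s + t" "a + b"] that
          sublinear_add[OF q, of "a + s *\<^sub>R y" "b + t *\<^sub>R y"]
        by (simp add: algebra_simps)
      then have "r (a + b) - (q (a + s *\<^sub>R y) - s * q y) \<le> r b" if "s \<ge> 0" for s
        using that by (intro greatest) auto
      then have "r (a + b) - r b \<le> r a"
        by (intro greatest) (simp add: algebra_simps)
      then show "r (a + b) \<le> r a + r b" by simp
    next
      fix c :: real and a assume c: "c > 0"
      have "r (c *\<^sub>R a) / c \<le> r a"
      proof (rule greatest)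
        fix t :: real assume t: "t \<ge> 0"
        have "c *\<^sub>R a + (c * t) *\<^sub>R y = c *\<^sub>R (a + t *\<^sub>R y)"
          by (simp add: algebra_simps)
        then have "q (c *\<^sub>R a + (c * t) *\<^sub>R y) = c * q (a + t *\<^sub>R y)"
          using sublinear_scaleR[OF q, of c "a + t *\<^sub>R y"] c by simp
        then show "r (c *\<^sub>R a) / c \<le> q (a + t *\<^sub>R y) - t * q y"
          using lower[of "c * t" "c *\<^sub>R a"] c t by (simp add: field_simps)
      qed
      then show "r (c *\<^sub>R a) \<le> c * r a" using c by (simp add: field_simps)
    qed
    then have "r = q"
      using lower[of 0] by (intro min) auto
    then show ?thesis using lower[of 1 x] by simp
  qed
  have add: "q (x + y) = q x + q y" for x y
    using super sublinear_add[OF q] by (simp add: order.antisym)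
  have neg: "q (- x) = - q x" for x
    using add[of x "- x"] sublinear_0[OF q] by simp
  show "linear q"
  proof (rule linearI)
    fix c x
    show "q (c *\<^sub>R x) = c *\<^sub>R q x"
    proof (cases "c \<ge> 0")
      case False
      then show ?thesis
        using sublinear_scaleR[OF q, of "- c" x] neg[of "c *\<^sub>R x"] by simp
    qed (use sublinear_scaleR[OF q] in auto)
  qed (rule add)
qed

text \<open>
  The functional to be extended is given by its graph \<open>S\<close>, which need not be known in advance to
  be single-valued.
\<close>

theorem Hahn_Banach:
  assumes p: "sublinear p" and S: "subspace S" and le: "\<And>x t. (x, t) \<in> S \<Longrightarrow> t \<le> p x"
  obtains L where "linear L" "\<And>x. L x \<le> p x" "\<And>x t. (x, t) \<in> S \<Longrightarrow> L x = t"
proof -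
  \<comment> \<open>The infimal convolution of \<open>p\<close> with the graph: every linear
    \<open>L\<close> below \<open>p\<close> with graph containing \<open>S\<close> must lie below
    this \<open>q\<close>. Conversely, taking \<open>w\<close> to be the point over \<open>x\<close>
    itself shows that anything below \<open>q\<close> is at most \<open>t\<close> at
    \<open>(x, t)\<close>.\<close>
  define q where "q x = (INF w\<in>S. p (x - fst w) + snd w)" for x
  have le': "- p (- fst w) \<le> snd w" if "w \<in> S" for w
    using le[of "- fst w" "- snd w"] subspace_neg[OF S that] by (simp add: uminus_prod_def)
  have bdd: "bdd_below ((\<lambda>w. p (x - fst w) + snd w) ` S)" for x
  proof (rule bdd_belowI2)
    fix w assume w: "w \<in> S"
    show "- p (- x) \<le> p (x - fst w) + snd w"
      using sublinear_add[OF p, of "x - fst w" "- x"] le'[OF w] by simp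
  qed
  have lower: "q x \<le> p (x - fst w) + snd w" if "w \<in> S" for w x
    unfolding q_def using that by (intro cINF_lower[OF bdd]) auto
  have greatest: "z \<le> q x" if "\<And>w. w \<in> S \<Longrightarrow> z \<le> p (x - fst w) + snd w" for z x
    unfolding q_def using that subspace_0[OF S] by (intro cINF_greatest) auto
  have "sublinear q"
  proof (rule sublinearI)
    fix x y
    have "q (x + y) - (p (x - fst v) + snd v) \<le> p (y - fst w) + snd w"
      if "v \<in> S" "w \<in> S" for v w
      using lower[OF subspace_add[OF S that], of "x + y"]
        sublinear_add[OF p, of "x - fst v" "y - fst w"]
      by (simp add: algebra_simps)
    then have "q (x + y) - (p (x - fst v) + snd v) \<le> q y" if "v \<in> S" for v
      using that by (intro greatest) auto
    then have "q (x + y) - q y \<le> q x"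
      by (intro greatest) (simp add: algebra_simps)
    then show "q (x + y) \<le> q x + q y" by simp
  next
    fix c :: real and x assume c: "c > 0"
    have "q (c *\<^sub>R x) / c \<le> q x"
    proof (rule greatest)
      fix w assume w: "w \<in> S"
      have "p (c *\<^sub>R x - c *\<^sub>R fst w) = c * p (x - fst w)"
        using sublinear_scaleR[OF p, of c "x - fst w"] c by (simp add: scaleR_diff_right)
      then show "q (c *\<^sub>R x) / c \<le> p (x - fst w) + snd w"
        using lower[OF subspace_scale[OF S w, of c], of "c *\<^sub>R x"] c by (simp add: field_simps)
    qed
    then show "q (c *\<^sub>R x) \<le> c * q x" using c by (simp add: field_simps)
  qed
  then obtain L where L: "sublinear L" "\<And>x. L x \<le> q x"
    "\<forall>r. sublinear r \<longrightarrow> (\<forall>x. r x \<le> L x) \<longrightarrow> r = L"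
    by (rule sublinear_minimal_below) blast
  have lin: "linear L" using L by (intro minimal_sublinear_imp_linear) auto
  have below: "L x \<le> t" if "(x, t) \<in> S" for x t
    using L(2)[of x] lower[OF that, of x] sublinear_0[OF p] by simp
  show thesis
  proof (rule that[OF lin])
    show "L x \<le> p x" for x
      using L(2)[of x] lower[OF subspace_0[OF S], of x] by simp
    \<comment> \<open>\<open>S\<close> is closed under negation, so the upper bound at
      \<open>- x\<close> is the missing lower bound at \<open>x\<close>.\<close>
    show "L x = t" if "(x, t) \<in> S" for x t
      using below[OF that] below[of "- x" "- t"] subspace_neg[OF S that] linear_neg[OF lin, of x]
      by (simp add: uminus_prod_def)
  qed
qed

subsection \<open>The Riesz representation theorem\<close>

lemma Urysohn_compact_t2:
  fixes S T :: "'a::t2_space set"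
  assumes "compact (UNIV :: 'a set)" "closed S" "closed T" "S \<inter> T = {}"
  obtains g :: "'a \<Rightarrow> real" where "continuous_on UNIV g" "\<And>x. 0 \<le> g x" "\<And>x. g x \<le> 1"
    "\<And>x. x \<in> S \<Longrightarrow> g x = 0" "\<And>x. x \<in> T \<Longrightarrow> g x = 1"
proof -
  have "normal_space (euclidean :: 'a topology)"
    using assms(1) separation_t2
    by (intro compact_Hausdorff_or_regular_imp_normal_space)
      (auto simp: compact_space_def Hausdorff_space_def disjnt_def)
  then obtain g :: "'a \<Rightarrow> real"
    where "continuous_map euclidean (top_of_set {0..1}) g" "g ` S \<subseteq> {0}" "g ` T \<subseteq> {1}"
    using assms by (auto intro: Urysohn_lemma[of euclidean S T 0 1] simp: disjnt_def)
  then show thesis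
    by (intro that[of g]) (auto simp: continuous_map_in_subtopology)
qed

lemma compact_bounded_function:
  fixes f :: "'a::topological_space \<Rightarrow> 'b::real_normed_vector"
  assumes "compact (UNIV :: 'a set)" "continuous_on UNIV f"
  obtains B where "B > 0" "\<And>x. norm (f x) \<le> B"
  using compact_imp_bounded[OF compact_continuous_image[OF assms(2,1)]]
  by (auto simp: bounded_pos)

section \<open>Normalized positive functionals and the content of open sets\<close>

locale positive_functional =
  fixes I :: "('a::t2_space \<Rightarrow> real) \<Rightarrow> real"
  assumes compact_UNIV: "compact (UNIV :: 'a set)"
    and add: "continuous_on UNIV f \<Longrightarrow> continuous_on UNIV g \<Longrightarrow> I (\<lambda>x. f x + g x) = I f + I g"
    and scale: "continuous_on UNIV f \<Longrightarrow> I (\<lambda>x. c * f x) = c * I f"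
    and nonneg: "continuous_on UNIV f \<Longrightarrow> (\<And>x. 0 \<le> f x) \<Longrightarrow> 0 \<le> I f"
    and one: "I (\<lambda>x. 1) = 1"
begin

lemma zero: "I (\<lambda>x. 0) = 0"
  using scale[of "\<lambda>x. 0" 0] by simp

lemma mono:
  assumes "continuous_on UNIV f" "continuous_on UNIV g" "\<And>x. f x \<le> g x"
  shows "I f \<le> I g"
proof -
  have "I g = I (\<lambda>x. f x + (g x - f x))" by simp
  also have "\<dots> = I f + I (\<lambda>x. g x - f x)"
    using assms by (intro add continuous_intros)
  finally show ?thesis
    using assms nonneg[of "\<lambda>x. g x - f x"] by (simp add: continuous_intros)
qed

lemma const: "I (\<lambda>x. c) = c"
  using scale[of "\<lambda>x. 1" c] one by simp

lemma sum_lessThan: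
  assumes "\<And>i. continuous_on UNIV (f i)"
  shows "I (\<lambda>x. \<Sum>i<(n::nat). f i x) = (\<Sum>i<n. I (f i))"
proof (induction n)
  case (Suc n)
  have "I (\<lambda>x. (\<Sum>i<n. f i x) + f n x) = I (\<lambda>x. \<Sum>i<n. f i x) + I (f n)"
    by (intro add continuous_intros assms)
  then show ?case using Suc by simp
qed (simp add: zero)

text \<open>
  Cutoff functions only vanish outside \<open>U\<close>; where the classical argument needs compact support
  inside \<open>U\<close>, the truncation \<open>max 0 (f - e)\<close> is used, which costs at most \<open>e\<close>.
\<close>

definition cutoffs :: "'a set \<Rightarrow> ('a \<Rightarrow> real) set" where
  "cutoffs U = {f. continuous_on UNIV f \<and> (\<forall>x. 0 \<le> f x \<and> f x \<le> 1) \<and> (\<forall>x. x \<notin> U \<longrightarrow> f x = 0)}"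

definition content :: "'a set \<Rightarrow> ennreal" where
  "content U = (SUP f\<in>cutoffs U. ennreal (I f))"

lemma content_upper: "f \<in> cutoffs U \<Longrightarrow> ennreal (I f) \<le> content U"
  by (auto simp: content_def intro: SUP_upper)

lemma content_mono: "U \<subseteq> V \<Longrightarrow> content U \<le> content V"
  unfolding content_def by (rule SUP_subset_mono) (auto simp: cutoffs_def)

lemma content_empty: "content {} = 0"
proof -
  have "cutoffs {} = {\<lambda>x. 0}" by (auto simp: cutoffs_def)
  then show ?thesis by (simp add: content_def zero)
qed

lemma content_UNIV: "content UNIV = 1"
proof (rule antisym)
  show "content UNIV \<le> 1"
    unfolding content_def
  proof (rule SUP_least)
    fix f assume "f \<in> cutoffs UNIV"
    then have "I f \<le> I (\<lambda>x. 1)" by (intro mono) (auto simp: cutoffs_def)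
    then show "ennreal (I f) \<le> 1" using one by (simp add: ennreal_le_1)
  qed
  show "1 \<le> content UNIV"
    using content_upper[of "\<lambda>x. 1" UNIV] one by (simp add: cutoffs_def)
qed

lemma cutoff_truncate:
  assumes f: "f \<in> cutoffs U" and e: "0 \<le> e"
  defines "f' \<equiv> \<lambda>x. max 0 (f x - e)"
  shows "f' \<in> cutoffs U" "I f \<le> I f' + e"
proof -
  have cf: "continuous_on UNIV f" using f by (simp add: cutoffs_def)
  then have cf': "continuous_on UNIV f'" unfolding f'_def by (intro continuous_intros)
  have "f x - e \<le> 1" for x using f e by (smt (verit) cutoffs_def mem_Collect_eq)
  then show "f' \<in> cutoffs U" using f e cf' by (auto simp: cutoffs_def f'_def)
  have "I f \<le> I (\<lambda>x. f' x + e)"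
    by (intro mono continuous_intros cf cf') (auto simp: f'_def)
  also have "\<dots> = I f' + e" using add[OF cf', of "\<lambda>x. e"] const[of e] by simp
  finally show "I f \<le> I f' + e" .
qed

text \<open>A bound on the truncations suffices because \<open>e\<close> is arbitrary. The gain is
  that a truncation vanishes off the compact set \<open>{x. e \<le> f x}\<close>, which is contained
  in \<open>U\<close>.\<close>

lemma content_leI:
  assumes "\<And>f e. f \<in> cutoffs U \<Longrightarrow> 0 < e \<Longrightarrow> ennreal (I (\<lambda>x. max 0 (f x - e))) \<le> c"
  shows "content U \<le> c"
  unfolding content_def
proof (rule SUP_least, rule ennreal_le_epsilon)
  fix f and e :: real assume f: "f \<in> cutoffs U" and e: "0 < e"
  let ?f' = "\<lambda>x. max 0 (f x - e)"
  have "0 \<le> I ?f'"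
    using cutoff_truncate(1)[OF f, of e] e by (intro nonneg) (auto simp: cutoffs_def)
  have "ennreal (I f) \<le> ennreal (I ?f' + e)"
    using cutoff_truncate(2)[OF f, of e] e by (intro ennreal_leI) auto
  also have "\<dots> = ennreal (I ?f') + ennreal e"
    using \<open>0 \<le> I ?f'\<close> e by simp
  also have "\<dots> \<le> c + ennreal e"
    using assms[OF f e] by (rule add_right_mono)
  finally show "ennreal (I f) \<le> c + ennreal e" .
qed

lemma closed_superlevel:
  assumes "continuous_on UNIV (f :: 'a \<Rightarrow> real)"
  shows "closed {x. e \<le> f x}"
  using assms by (intro closed_Collect_le continuous_intros)

text \<open>A partition of unity on the closed set \<open>K\<close>: the sets \<open>K - U\<close>
  and \<open>K - V\<close> are disjoint, and a Urysohn function \<open>g\<close> between them makes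
  \<open>f' * g\<close> vanish off \<open>U\<close> and \<open>f' * (1 - g)\<close> vanish off
  \<open>V\<close>.\<close>

lemma content_Un:
  assumes U: "open U" and V: "open V"
  shows "content (U \<union> V) \<le> content U + content V"
proof (rule content_leI)
  fix f and e :: real assume f: "f \<in> cutoffs (U \<union> V)" and e: "0 < e"
  define f' where "f' = (\<lambda>x. max 0 (f x - e))"
  have f': "f' \<in> cutoffs (U \<union> V)"
    using cutoff_truncate(1)[OF f, of e] e by (simp add: f'_def)
  define K where "K = {x. e \<le> f x}"
  have "closed K" using f closed_superlevel[of f e] by (simp add: K_def cutoffs_def)
  moreover have KUV: "K \<subseteq> U \<union> V" using f e by (auto simp: K_def cutoffs_def)
  ultimately obtain g :: "'a \<Rightarrow> real"
    where g: "continuous_on UNIV g" "\<And>x. 0 \<le> g x" "\<And>x. g x \<le> 1"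
      "\<And>x. x \<in> K - U \<Longrightarrow> g x = 0" "\<And>x. x \<in> K - V \<Longrightarrow> g x = 1"
    using Urysohn_compact_t2[OF compact_UNIV, of "K - U" "K - V"] U V by blast
  have f'0: "f' x = 0" if "x \<notin> K" for x using that by (auto simp: f'_def K_def)
  have cont: "continuous_on UNIV f'" and f01: "\<And>x. 0 \<le> f' x" "\<And>x. f' x \<le> 1"
    using f' by (auto simp: cutoffs_def)
  have "f' x * g x = 0" if "x \<notin> U" for x
    using f'0[of x] g(4)[of x] that by (cases "x \<in> K") auto
  then have fU: "(\<lambda>x. f' x * g x) \<in> cutoffs U"
    unfolding cutoffs_def using g(1-3) f01 cont
    by (auto intro!: continuous_intros mult_le_one)
  have "f' x * (1 - g x) = 0" if "x \<notin> V" for x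
    using f'0[of x] g(5)[of x] that by (cases "x \<in> K") auto
  then have fV: "(\<lambda>x. f' x * (1 - g x)) \<in> cutoffs V"
    unfolding cutoffs_def using g(1-3) f01 cont
    by (auto intro!: continuous_intros mult_le_one)
  have "I f' = I (\<lambda>x. f' x * g x + f' x * (1 - g x))"
    by (simp add: algebra_simps)
  also have "\<dots> = I (\<lambda>x. f' x * g x) + I (\<lambda>x. f' x * (1 - g x))"
    using fU fV by (intro add) (auto simp: cutoffs_def)
  finally have "ennreal (I f') = ennreal (I (\<lambda>x. f' x * g x)) + ennreal (I (\<lambda>x. f' x * (1 - g x)))"
    using fU fV by (simp add: nonneg cutoffs_def)
  also have "\<dots> \<le> content U + content V"
    by (intro add_mono content_upper fU fV)
  finally show "ennreal (I (\<lambda>x. max 0 (f x - e))) \<le> content U + content V"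
    by (simp add: f'_def)
qed

lemma content_UN_lessThan:
  assumes "\<And>i. open (U i)"
  shows "content (\<Union>i<(n::nat). U i) \<le> (\<Sum>i<n. content (U i))"
proof (induction n)
  case (Suc n)
  have "content (\<Union>i<Suc n. U i) \<le> content (\<Union>i<n. U i) + content (U n)"
    using content_Un[of "\<Union>i<n. U i" "U n"] assms
    by (simp add: lessThan_Suc Un_commute open_UN)
  also have "\<dots> \<le> (\<Sum>i<n. content (U i)) + content (U n)"
    using Suc by (rule add_right_mono)
  finally show ?case by simp
qed (simp add: content_empty)

text \<open>Compactness of \<open>{x. e \<le> f x}\<close> leaves finitely many of the open sets, so
  that finite subadditivity applies to the truncation.\<close>

lemma content_UN:
  fixes U :: "nat \<Rightarrow> 'a set"
  assumes U: "\<And>i. open (U i)"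
  shows "content (\<Union>i. U i) \<le> (\<Sum>i. content (U i))"
proof (rule content_leI)
  fix f and e :: real assume f: "f \<in> cutoffs (\<Union>i. U i)" and e: "0 < e"
  have "closed {x. e \<le> f x}" using f closed_superlevel[of f e] by (simp add: cutoffs_def)
  then have K: "compact {x. e \<le> f x}"
    using compact_Int_closed[OF compact_UNIV, of "{x. e \<le> f x}"] by simp
  have f0: "f x = 0" if "x \<notin> (\<Union>i. U i)" for x
    using f that unfolding cutoffs_def by blast
  have "x \<in> (\<Union>i. U i)" if "e \<le> f x" for x
    using f0[of x] e that by (cases "x \<in> (\<Union>i. U i)") simp_all
  then have sub: "{x. e \<le> f x} \<subseteq> (\<Union>i\<in>UNIV. U i)" by blast
  obtain C where "C \<subseteq> UNIV" and C: "finite C" "{x. e \<le> f x} \<subseteq> (\<Union>i\<in>C. U i)"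
    by (rule compactE_image[OF K U sub])
  then obtain n where n: "C \<subseteq> {..<n}"
    using finite_nat_iff_bounded by blast
  let ?f' = "\<lambda>x. max 0 (f x - e)"
  have "?f' x = 0" if "x \<notin> (\<Union>i<n. U i)" for x
  proof -
    have "x \<notin> {x. e \<le> f x}" using C(2) n that by blast
    then show ?thesis by simp
  qed
  then have "?f' \<in> cutoffs (\<Union>i<n. U i)"
    using cutoff_truncate(1)[OF f, of e] e by (auto simp: cutoffs_def)
  then have "ennreal (I ?f') \<le> content (\<Union>i<n. U i)" by (rule content_upper)
  also have "\<dots> \<le> (\<Sum>i<n. content (U i))" by (rule content_UN_lessThan[OF U])
  also have "\<dots> \<le> (\<Sum>i. content (U i))" by (rule sum_le_suminf) auto
  finally show "ennreal (I ?f') \<le> (\<Sum>i. content (U i))" .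
qed

section \<open>The outer measure and measurability of open sets\<close>

definition outer :: "'a set \<Rightarrow> ennreal" where
  "outer E = (INF U\<in>{U. open U \<and> E \<subseteq> U}. content U)"

lemma outer_lower: "open U \<Longrightarrow> E \<subseteq> U \<Longrightarrow> outer E \<le> content U"
  unfolding outer_def by (rule INF_lower) simp

lemma outer_open: "open U \<Longrightarrow> outer U = content U"
  by (rule antisym[OF outer_lower]) (auto simp: outer_def intro!: INF_greatest content_mono)

lemma outer_mono: "E \<subseteq> F \<Longrightarrow> outer E \<le> outer F"
  unfolding outer_def by (rule INF_superset_mono) auto

lemma outer_measure_space_outer: "outer_measure_space (Pow UNIV) outer"
  unfolding outer_measure_space_def
proof (intro conjI)
  show "positive (Pow UNIV) outer"
    by (simp add: positive_def outer_open content_empty)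
  show "increasing (Pow UNIV) outer"
    by (simp add: increasing_def outer_mono)
  show "countably_subadditive (Pow UNIV) outer"
    unfolding countably_subadditive_def
  proof (intro allI impI, rule ennreal_le_epsilon)
    fix A :: "nat \<Rightarrow> 'a set" and e :: real
    assume e: "0 < e" and fin: "(\<Sum>i. outer (A i)) < top"
    have "outer (A n) < outer (A n) + e * (1/2)^Suc n" for n
      using fin e by (auto simp add: less_top dest!: ennreal_suminf_lessD)
    then have "\<exists>U. open U \<and> A n \<subseteq> U \<and> content U < outer (A n) + e * (1/2)^Suc n" for n
      by (subst (asm) (1) outer_def) (auto simp: INF_less_iff)
    then obtain U where U: "\<And>n. open (U n)" "\<And>n. A n \<subseteq> U n"
      "\<And>n. content (U n) < outer (A n) + e * (1/2)^Suc n"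
      by metis
    have "outer (\<Union>i. A i) \<le> content (\<Union>i. U i)"
      using U(1,2) by (intro outer_lower) (auto simp: open_UN)
    also have "\<dots> \<le> (\<Sum>i. content (U i))" by (rule content_UN[OF U(1)])
    also have "\<dots> \<le> (\<Sum>n. outer (A n) + e * (1/2) ^ Suc n)"
      by (intro suminf_le) (auto simp del: power_Suc intro: less_imp_le[OF U(3)])
    also have "\<dots> = (\<Sum>n. outer (A n)) + (\<Sum>n. ennreal e * ennreal ((1/2) ^ Suc n))"
      using e by (subst suminf_add[symmetric])
        (auto simp del: ennreal_suminf_cmult simp add: ennreal_mult[symmetric])
    also have "\<dots> = (\<Sum>n. outer (A n)) + e"
      unfolding ennreal_suminf_cmult
      by (subst suminf_ennreal_eq[OF zero_le_power power_half_series]) auto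
    finally show "outer (\<Union>i. A i) \<le> (\<Sum>n. outer (A n)) + ennreal e" .
  qed
qed

text \<open>A truncated cutoff \<open>f'\<close> of \<open>V \<inter> U\<close> leaves room for a
  second function: \<open>W\<close> is an open neighbourhood of \<open>V - U\<close> on which
  \<open>f'\<close> vanishes, so \<open>f' + g\<close> is still a cutoff of \<open>V\<close> for
  every cutoff \<open>g\<close> of \<open>W\<close>.\<close>

lemma outer_open_split:
  assumes U: "open U" and V: "open V"
  shows "outer (V \<inter> U) + outer (V - U) \<le> content V"
proof -
  have "content (V \<inter> U) \<le> content V - outer (V - U)"
  proof (rule content_leI)
    fix f and e :: real assume f: "f \<in> cutoffs (V \<inter> U)" and e: "0 < e"
    define f' where "f' = (\<lambda>x. max 0 (f x - e))"
    have f': "f' \<in> cutoffs (V \<inter> U)"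
      using cutoff_truncate(1)[OF f, of e] e by (simp add: f'_def)
    define W where "W = V - {x. e \<le> f x}"
    have W: "open W" unfolding W_def
      using f by (intro open_Diff V closed_superlevel) (auto simp: cutoffs_def)
    have "V - U \<subseteq> W" using f e by (auto simp: W_def cutoffs_def)
    then have "ennreal (I f') + outer (V - U) \<le> ennreal (I f') + content W"
      by (intro add_left_mono outer_lower W)
    also have "\<dots> = (SUP g\<in>cutoffs W. ennreal (I f') + ennreal (I g))"
      unfolding content_def
      by (rule ennreal_SUP_add_right) (auto simp: cutoffs_def intro!: exI[of _ "\<lambda>x. 0"])
    also have "\<dots> \<le> content V"
    proof (rule SUP_least)
      fix g assume g: "g \<in> cutoffs W"
      have fg: "f' x = 0 \<or> g x = 0" for x
        using g by (cases "e \<le> f x") (auto simp: f'_def W_def cutoffs_def)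
      have "(\<lambda>x. f' x + g x) \<in> cutoffs V"
        unfolding cutoffs_def
      proof (intro CollectI conjI allI impI)
        show "continuous_on UNIV (\<lambda>x. f' x + g x)"
          using f' g by (auto simp: cutoffs_def intro!: continuous_intros)
        show "0 \<le> f' x + g x" for x
          using f' g by (auto simp: cutoffs_def)
        show "f' x + g x \<le> 1" for x
          using fg[of x] f' g by (auto simp: cutoffs_def)
        show "f' x + g x = 0" if "x \<notin> V" for x
          using f' g that by (auto simp: cutoffs_def W_def)
      qed
      then have "ennreal (I (\<lambda>x. f' x + g x)) \<le> content V" by (rule content_upper)
      moreover have "I (\<lambda>x. f' x + g x) = I f' + I g" "0 \<le> I f'" "0 \<le> I g"
        using f' g by (auto simp: cutoffs_def intro: add nonneg)
      ultimately show "ennreal (I f') + ennreal (I g) \<le> content V"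
        by simp
    qed
    finally have "ennreal (I f') + outer (V - U) \<le> content V" .
    then show "ennreal (I (\<lambda>x. max 0 (f x - e))) \<le> content V - outer (V - U)"
      by (simp add: f'_def ennreal_le_minus_iff)
  qed
  moreover have "outer (V - U) \<le> content V" using V by (intro outer_lower) auto
  moreover have "content V \<noteq> top"
    using content_mono[of V UNIV] content_UNIV by (auto simp: top_unique)
  ultimately show ?thesis
    using U V by (simp add: outer_open open_Int)
      (metis add_right_mono diff_add_cancel_ennreal)
qed

text \<open>By Caratheodory's theorem only open sets need to be tested. Passing to open
  \<open>V\<close> above an arbitrary test set \<open>E\<close> turns the splitting condition into
  \<open>outer_open_split\<close>.\<close>

lemma borel_subset_lambda_system: "sets borel \<subseteq> lambda_system UNIV (Pow UNIV) outer"
proof -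
  have "measure_space UNIV (lambda_system UNIV (Pow UNIV) outer) outer"
    by (rule sigma_algebra.caratheodory_lemma[OF sigma_algebra_Pow outer_measure_space_outer])
  then interpret sa: sigma_algebra UNIV "lambda_system UNIV (Pow UNIV) outer"
    by (simp add: measure_space_def)
  have "U \<in> lambda_system UNIV (Pow UNIV) outer" if U: "open U" for U
  proof -
    have "outer (E \<inter> U) + outer (E - U) = outer E" for E
    proof (rule antisym)
      show "outer (E \<inter> U) + outer (E - U) \<le> outer E"
        unfolding outer_def[of E]
      proof (rule INF_greatest)
        fix V assume V: "V \<in> {V. open V \<and> E \<subseteq> V}"
        have "outer (E \<inter> U) + outer (E - U) \<le> outer (V \<inter> U) + outer (V - U)"
          using V by (intro add_mono outer_mono) auto
        also have "\<dots> \<le> content V" using V U by (intro outer_open_split) auto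
        finally show "outer (E \<inter> U) + outer (E - U) \<le> content V" .
      qed
      have "subadditive (Pow UNIV) outer"
        using outer_measure_space_outer ring_of_sets.countably_subadditive_subadditive[of UNIV "Pow UNIV" outer]
        by (auto simp: outer_measure_space_def ring_of_sets_iff)
      moreover have "(E \<inter> U) \<inter> (E - U) = {}" by blast
      ultimately have "outer ((E \<inter> U) \<union> (E - U)) \<le> outer (E \<inter> U) + outer (E - U)"
        unfolding subadditive_def by blast
      then show "outer E \<le> outer (E \<inter> U) + outer (E - U)" by (simp add: Int_Diff_Un)
    qed
    then show ?thesis
      by (subst algebra.lambda_system_eq[OF algebra_Pow]) auto
  qed
  then show ?thesis
    unfolding borel_def by (intro sa.sigma_sets_subset sets_measure_of[THEN equalityD1, THEN order_trans]) auto
qed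

section \<open>The representing measure, its regularity and its integral\<close>

definition riesz_measure :: "'a measure" where
  "riesz_measure = measure_of UNIV (sets borel) outer"

lemma sets_riesz_measure [measurable_cong]: "sets riesz_measure = sets borel"
  using sets.sigma_sets_eq[of "borel :: 'a measure"] by (simp add: riesz_measure_def)

lemma space_riesz_measure [simp]: "space riesz_measure = UNIV"
  by (simp add: riesz_measure_def)

lemma emeasure_riesz_measure:
  assumes "E \<in> sets borel"
  shows "emeasure riesz_measure E = outer E"
proof -
  have "measure_space UNIV (lambda_system UNIV (Pow UNIV) outer) outer"
    by (rule sigma_algebra.caratheodory_lemma[OF sigma_algebra_Pow outer_measure_space_outer])
  then have "measure_space UNIV (sets borel) outer"
    using sets.sigma_algebra_axioms[of "borel :: 'a measure"]
    by (intro measure_down[OF _ _ borel_subset_lambda_system]) simp_all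
  then show ?thesis
    unfolding riesz_measure_def measure_space_def
    by (elim conjE) (rule emeasure_measure_of_sigma[OF _ _ _ assms])
qed

lemma emeasure_riesz_measure_UNIV: "emeasure riesz_measure UNIV = 1"
  by (simp add: emeasure_riesz_measure outer_open content_UNIV)

lemma finite_measure_riesz_measure: "finite_measure riesz_measure"
  by (intro finite_measureI) (simp add: emeasure_riesz_measure_UNIV)

text \<open>Outer regularity is built into \<open>outer\<close>. Inner regularity is outer
  regularity of the complement, since complements of open sets are compact here and the total mass
  is 1.\<close>

lemma regular_riesz_measure: "regular_borel_measure_on UNIV riesz_measure"
  unfolding regular_borel_measure_on_def
proof (intro conjI ballI)
  let ?m = riesz_measure
  show "sets ?m = sets (restrict_space borel UNIV)" by (simp add: sets_riesz_measure)
  show "finite_measure ?m" by (rule finite_measure_riesz_measure)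
  have outer: "emeasure ?m E = (INF U\<in>{U. open U \<and> E \<subseteq> U}. emeasure ?m U)"
    if "E \<in> sets borel" for E
    unfolding emeasure_riesz_measure[OF that] outer_def
    by (intro INF_cong) (auto simp: emeasure_riesz_measure outer_open)
  fix E assume "E \<in> sets ?m"
  then have E: "E \<in> sets borel" by (simp add: sets_riesz_measure)
  show "emeasure ?m E = (INF U\<in>{U. openin (top_of_set UNIV) U \<and> E \<subseteq> U}. emeasure ?m U)"
    using outer[OF E] by simp
  have compl: "emeasure ?m (- F) = 1 - emeasure ?m F" if "F \<in> sets borel" for F
    using emeasure_compl[of F ?m] that emeasure_riesz_measure_UNIV
      finite_measure.emeasure_finite[OF finite_measure_riesz_measure, of F]
    by (simp add: sets_riesz_measure Compl_eq_Diff_UNIV)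
  show "emeasure ?m E = (SUP K\<in>{K. compact K \<and> K \<subseteq> E}. emeasure ?m K)"
  proof (rule antisym)
    have "emeasure ?m E = 1 - (INF U\<in>{U. open U \<and> - E \<subseteq> U}. emeasure ?m U)"
      using compl[of "- E"] outer[of "- E"] E by (simp add: borel_comp)
    also have "\<dots> = (SUP U\<in>{U. open U \<and> - E \<subseteq> U}. 1 - emeasure ?m U)"
      by (intro SUP_const_minus_ennreal[symmetric]) auto
    also have "\<dots> \<le> (SUP K\<in>{K. compact K \<and> K \<subseteq> E}. emeasure ?m K)"
    proof (rule SUP_least)
      fix U assume U: "U \<in> {U. open U \<and> - E \<subseteq> U}"
      then have "compact (- U)" using compact_Int_closed[OF compact_UNIV, of "- U"] by auto
      then have "emeasure ?m (- U) \<le> (SUP K\<in>{K. compact K \<and> K \<subseteq> E}. emeasure ?m K)"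
        using U by (intro SUP_upper) auto
      then show "1 - emeasure ?m U \<le> (SUP K\<in>{K. compact K \<and> K \<subseteq> E}. emeasure ?m K)"
        using U by (simp add: compl)
    qed
    finally show "emeasure ?m E \<le> (SUP K\<in>{K. compact K \<and> K \<subseteq> E}. emeasure ?m K)" .
    show "(SUP K\<in>{K. compact K \<and> K \<subseteq> E}. emeasure ?m K) \<le> emeasure ?m E"
      using E by (intro SUP_least emeasure_mono) (auto simp: sets_riesz_measure)
  qed
qed

lemma integrable_riesz_measure:
  fixes f :: "'a \<Rightarrow> real"
  assumes "continuous_on UNIV f"
  shows "integrable riesz_measure f"
proof -
  obtain B where "\<And>x. norm (f x) \<le> B"
    using compact_bounded_function[OF compact_UNIV assms] by metis
  then show ?thesis
    using borel_measurable_continuous_onI[OF assms]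
    by (intro finite_measure.integrable_const_bound[OF finite_measure_riesz_measure, of _ B])
      (auto simp: measurable_cong_sets[OF sets_riesz_measure refl])
qed

text \<open>Cuts a number into layers of height one; applied to \<open>n * f x\<close>, this is the
  layer decomposition used next.\<close>

lemma sum_slices:
  "(\<Sum>i<n. max 0 (min 1 (t - real i))) = max 0 (min t (real n))"
  by (induction n) (auto simp: min_def max_def)

text \<open>The slice \<open>s (Suc i)\<close> is a cutoff of an open set on which the slice
  \<open>s i\<close> equals 1, so \<open>I (s (Suc i))\<close> is at most the measure of that set
  and hence at most the integral of \<open>s i\<close>. The index shift costs a total of 1 for the
  function \<open>n * f\<close>, which is negligible as \<open>n\<close> grows.\<close>

lemma le_integral_riesz_measure:
  assumes f: "continuous_on UNIV f" and f01: "\<And>x. 0 \<le> f x" "\<And>x. f x \<le> 1"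
  shows "I f \<le> (\<integral>x. f x \<partial>riesz_measure)"
proof -
  let ?m = riesz_measure
  interpret finite_measure ?m by (rule finite_measure_riesz_measure)
  have bound: "real n * I f \<le> 1 + real n * (\<integral>x. f x \<partial>?m)" for n
  proof -
    define s where "s i x = max 0 (min 1 (real n * f x - real i))" for i x
    have s: "continuous_on UNIV (s i)" for i
      unfolding s_def using f by (intro continuous_intros)
    have sum_s: "(\<Sum>i<n. s i x) = real n * f x" for x
      using f01[of x] mult_left_le[of "f x" "real n"] unfolding s_def sum_slices by simp
    have step: "I (s (Suc i)) \<le> (\<integral>x. s i x \<partial>?m)" for i
    proof -
      let ?U = "{x. real (Suc i) < real n * f x}"
      have U: "open ?U" using f by (intro open_Collect_less continuous_intros)
      have "s (Suc i) \<in> cutoffs ?U"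
        using s[of "Suc i"] by (auto simp: cutoffs_def s_def)
      then have "ennreal (I (s (Suc i))) \<le> emeasure ?m ?U"
        using content_upper U by (simp add: emeasure_riesz_measure outer_open)
      then have "I (s (Suc i)) \<le> measure ?m ?U"
        by (simp add: emeasure_eq_measure)
      also have "\<dots> = (\<integral>x. indicator ?U x \<partial>?m)" by simp
      also have "\<dots> \<le> (\<integral>x. s i x \<partial>?m)"
      proof (rule integral_mono)
        show "integrable ?m (indicator ?U :: 'a \<Rightarrow> real)"
          using U by (intro integrable_real_indicator)
            (auto simp: sets_riesz_measure emeasure_eq_measure)
        show "integrable ?m (s i)" by (rule integrable_riesz_measure[OF s])
      qed (auto simp: indicator_def s_def)
      finally show ?thesis .
    qed
    have "real n * I f = I (\<lambda>x. \<Sum>i<n. s i x)" using scale[OF f] by (simp add: sum_s)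
    also have "\<dots> = (\<Sum>i<n. I (s i))" by (rule sum_lessThan[OF s])
    \<comment> \<open>The nonnegative term for \<open>s n\<close> is added so that the sum can be
      shifted; the detached first term \<open>I (s 0)\<close> is at most 1.\<close>
    also have "\<dots> \<le> (\<Sum>i<Suc n. I (s i))"
      using nonneg[OF s[of n]] by (simp add: s_def)
    also have "\<dots> = I (s 0) + (\<Sum>i<n. I (s (Suc i)))" by (rule sum.lessThan_Suc_shift)
    also have "\<dots> \<le> 1 + (\<Sum>i<n. \<integral>x. s i x \<partial>?m)"
      using mono[OF s[of 0], of "\<lambda>x. 1"] one
      by (intro add_mono sum_mono step) (auto simp: s_def)
    also have "(\<Sum>i<n. \<integral>x. s i x \<partial>?m) = (\<integral>x. (\<Sum>i<n. s i x) \<partial>?m)"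
      by (intro Bochner_Integration.integral_sum[symmetric] integrable_riesz_measure s)
    also have "\<dots> = real n * (\<integral>x. f x \<partial>?m)" by (simp add: sum_s)
    finally show ?thesis .
  qed
  show ?thesis
  proof (rule ccontr)
    assume "\<not> ?thesis"
    then obtain n where "1 < real n * (I f - (\<integral>x. f x \<partial>?m))"
      using reals_Archimedean3[of "I f - (\<integral>x. f x \<partial>?m)"] by auto
    then show False using bound[of n] by (simp add: algebra_simps)
  qed
qed

text \<open>The inequality just proved, applied to both \<open>g\<close> and \<open>1 - g\<close>,
  gives equality when \<open>g\<close> takes values between 0 and 1. An affine rescaling by a bound
  of \<open>f\<close> reduces the general case to this one.\<close>

theorem integral_riesz_measure:
  assumes f: "continuous_on UNIV f"
  shows "(\<integral>x. f x \<partial>riesz_measure) = I f"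
proof -
  let ?m = riesz_measure
  interpret finite_measure ?m by (rule finite_measure_riesz_measure)
  have m1: "measure ?m UNIV = 1"
    using emeasure_riesz_measure_UNIV by (simp add: measure_def)
  have unit: "(\<integral>x. g x \<partial>?m) = I g"
    if g: "continuous_on UNIV g" "\<And>x. 0 \<le> g x" "\<And>x. g x \<le> 1" for g
  proof -
    have "I (\<lambda>x. 1 + (-1) * g x) = 1 + (-1) * I g"
      using add[of "\<lambda>x. 1" "\<lambda>x. (-1) * g x"] scale[of g "-1"] one g
      by (simp add: continuous_intros)
    moreover have "I (\<lambda>x. 1 + (-1) * g x) \<le> (\<integral>x. 1 + (-1) * g x \<partial>?m)"
      using g by (intro le_integral_riesz_measure continuous_intros) auto
    moreover have "(\<integral>x. 1 + (-1) * g x \<partial>?m) = 1 + (-1) * (\<integral>x. g x \<partial>?m)"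
      using integrable_riesz_measure[OF g(1)] m1 by simp
    ultimately show ?thesis using le_integral_riesz_measure[OF g] by simp
  qed
  obtain B where B: "B > 0" "\<And>x. norm (f x) \<le> B"
    using compact_bounded_function[OF compact_UNIV f] by metis
  have "0 \<le> B + f x" "f x \<le> B" for x using B(2)[of x] by auto
  then have "(\<integral>x. (f x + B) / (2 * B) \<partial>?m) = I (\<lambda>x. (f x + B) / (2 * B))"
    using B(1) f by (intro unit continuous_intros) (auto simp: divide_simps algebra_simps)
  moreover have "I (\<lambda>x. (f x + B) / (2 * B)) = (I f + B) / (2 * B)"
    using scale[of "\<lambda>x. f x + B" "1 / (2 * B)"] add[OF f, of "\<lambda>x. B"] const[of B] f
    by (simp add: continuous_intros)
  moreover have "(\<integral>x. (f x + B) / (2 * B) \<partial>?m) = ((\<integral>x. f x \<partial>?m) + B) / (2 * B)"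
    using integrable_riesz_measure[OF f] m1 by simp
  ultimately show ?thesis using B(1) by simp
qed

end

subsection \<open>Characters and representing measures\<close>

lemma Bcontfun_inverse_compact:
  fixes f :: "'a::topological_space \<Rightarrow> 'b::real_normed_vector"
  assumes "compact (UNIV :: 'a set)" "continuous_on UNIV f"
  shows "apply_bcontfun (Bcontfun f) = f"
proof -
  obtain B where "\<And>x. norm (f x) \<le> B"
    using compact_bounded_function[OF assms] by metis
  then show ?thesis
    by (intro Bcontfun_inverse bcontfun_normI[OF assms(2)])
qed

lemma borel_measurable_restrict_borel:
  assumes "sets m = sets (restrict_space borel S)" "f \<in> borel_measurable borel"
  shows "f \<in> borel_measurable m"
  using measurable_restrict_space1[OF assms(2), of S]
  by (simp add: measurable_cong_sets[OF assms(1) refl])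

lemma integrable_continuous_compact:
  fixes f :: "'a::topological_space \<Rightarrow> 'b::{real_normed_vector, banach, second_countable_topology}"
  assumes "compact (UNIV :: 'a set)" "finite_measure m" "sets m = sets (restrict_space borel S)"
    "continuous_on UNIV f"
  shows "integrable m f"
proof -
  obtain B where "\<And>x. norm (f x) \<le> B"
    using compact_bounded_function[OF assms(1,4)] by metis
  moreover have "f \<in> borel_measurable m"
    using borel_measurable_restrict_borel[OF assms(3) borel_measurable_continuous_onI[OF assms(4)]] .
  ultimately show ?thesis
    by (intro finite_measure.integrable_const_bound[OF assms(2), of _ B]) auto
qed

context
  fixes A :: "('a::topological_space \<Rightarrow> complex) set"
  assumes A: "closed_unital_subalgebra A"
begin

lemma subalgebra_continuous: "f \<in> A \<Longrightarrow> continuous_on UNIV f"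
  and subalgebra_const: "(\<lambda>x. c) \<in> A"
  and subalgebra_add: "f \<in> A \<Longrightarrow> g \<in> A \<Longrightarrow> (\<lambda>x. f x + g x) \<in> A"
  and subalgebra_mult: "f \<in> A \<Longrightarrow> g \<in> A \<Longrightarrow> (\<lambda>x. f x * g x) \<in> A"
  and subalgebra_scale: "f \<in> A \<Longrightarrow> (\<lambda>x. c * f x) \<in> A"
  and subalgebra_uniform_limit:
    "(\<And>n. F n \<in> A) \<Longrightarrow> uniform_limit UNIV F f sequentially \<Longrightarrow> f \<in> A"
  using A unfolding closed_unital_subalgebra_def by blast+

lemma subalgebra_diff: "f \<in> A \<Longrightarrow> g \<in> A \<Longrightarrow> (\<lambda>x. f x - g x) \<in> A"
  using subalgebra_add[of f "\<lambda>x. (-1) * g x"] subalgebra_scale[of g "-1"] by simp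

lemma subalgebra_sum: "(\<And>i. i \<in> I \<Longrightarrow> f i \<in> A) \<Longrightarrow> (\<lambda>x. \<Sum>i\<in>I. f i x) \<in> A"
  by (induction I rule: infinite_finite_induct) (auto intro: subalgebra_const subalgebra_add)

lemma subalgebra_power: "f \<in> A \<Longrightarrow> (\<lambda>x. f x ^ n) \<in> A"
  by (induction n) (auto intro: subalgebra_const subalgebra_mult)

lemma subalgebra_uniform_approx:
  assumes "\<And>e. e > 0 \<Longrightarrow> \<exists>g\<in>A. \<forall>x. norm (f x - g x) \<le> e"
  shows "f \<in> A"
proof -
  have "\<forall>n. \<exists>g\<in>A. \<forall>x. norm (f x - g x) \<le> inverse (Suc n)"
    by (intro allI assms) simp
  then obtain F where F: "\<And>n. F n \<in> A" "\<And>n x. norm (f x - F n x) \<le> inverse (Suc n)"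
    by metis
  have "uniform_limit UNIV F f sequentially"
  proof (rule uniform_limitI)
    fix e :: real assume "e > 0"
    then have "\<forall>\<^sub>F n in sequentially. inverse (Suc n) < e"
      using order_tendstoD(2)[OF LIMSEQ_inverse_real_of_nat] by blast
    then show "\<forall>\<^sub>F n in sequentially. \<forall>x\<in>UNIV. dist (F n x) (f x) < e"
    proof eventually_elim
      case (elim n)
      have "dist (F n x) (f x) < e" for x
        using F(2)[of x n] elim by (simp add: dist_norm norm_minus_commute)
      then show ?case by blast
    qed
  qed
  then show ?thesis by (rule subalgebra_uniform_limit[OF F(1)])
qed

text \<open>The Neumann series converges uniformly, and \<open>A\<close> is closed. This supplies
  the inverses behind the norm bound for characters and behind the distance from 1 to a proper
  ideal.\<close>

lemma subalgebra_inverse_one_minus: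
  assumes g: "g \<in> A" "\<And>x. norm (g x) \<le> r" "r < 1"
  shows "(\<lambda>x. 1 / (1 - g x)) \<in> A"
proof -
  have "0 \<le> r" using order_trans[OF norm_ge_zero g(2)] .
  then have "uniform_limit UNIV (\<lambda>n x. \<Sum>i<n. g x ^ i) (\<lambda>x. suminf (\<lambda>i. g x ^ i)) sequentially"
    using g by (intro Weierstrass_m_test[where M="\<lambda>i. r ^ i"])
      (auto simp: norm_power intro: power_mono summable_geometric)
  moreover have "suminf (\<lambda>i. g x ^ i) = 1 / (1 - g x)" for x
    using g(2)[of x] g(3) by (intro suminf_geometric) simp
  ultimately have "uniform_limit UNIV (\<lambda>n x. \<Sum>i<n. g x ^ i) (\<lambda>x. 1 / (1 - g x)) sequentially"
    by simp
  then show ?thesis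
    by (rule subalgebra_uniform_limit[rotated]) (intro subalgebra_sum subalgebra_power g(1))
qed

end

lemma spectrum_add: "\<phi> \<in> spectrum A \<Longrightarrow> f \<in> A \<Longrightarrow> g \<in> A \<Longrightarrow> \<phi> (\<lambda>x. f x + g x) = \<phi> f + \<phi> g"
  and spectrum_scale: "\<phi> \<in> spectrum A \<Longrightarrow> f \<in> A \<Longrightarrow> \<phi> (\<lambda>x. c * f x) = c * \<phi> f"
  and spectrum_mult: "\<phi> \<in> spectrum A \<Longrightarrow> f \<in> A \<Longrightarrow> g \<in> A \<Longrightarrow> \<phi> (\<lambda>x. f x * g x) = \<phi> f * \<phi> g"
  and spectrum_extensional: "\<phi> \<in> spectrum A \<Longrightarrow> \<phi> \<in> extensional A"
  by (auto simp: spectrum_def)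

context
  fixes A :: "('a::topological_space \<Rightarrow> complex) set" and \<phi> :: "('a \<Rightarrow> complex) \<Rightarrow> complex"
  assumes A: "closed_unital_subalgebra A" and phi: "\<phi> \<in> spectrum A"
begin

lemma spectrum_const: "\<phi> (\<lambda>x. c) = c"
proof -
  obtain f where f: "f \<in> A" "\<phi> f \<noteq> 0" using phi by (auto simp: spectrum_def)
  have "\<phi> f = \<phi> f * \<phi> (\<lambda>x. 1)"
    using spectrum_mult[OF phi f(1) subalgebra_const[OF A], of 1] by simp
  then have "\<phi> (\<lambda>x. 1) = 1" using f by simp
  then show ?thesis
    using spectrum_scale[OF phi subalgebra_const[OF A], of c 1] by simp
qed

lemma spectrum_diff: "f \<in> A \<Longrightarrow> g \<in> A \<Longrightarrow> \<phi> (\<lambda>x. f x - g x) = \<phi> f - \<phi> g"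
  using spectrum_add[OF phi, of f "\<lambda>x. (-1) * g x"] spectrum_scale[OF phi, of g "-1"]
    subalgebra_scale[OF A, of g "-1"] by simp

lemma spectrum_sum:
  "(\<And>i. i \<in> I \<Longrightarrow> f i \<in> A) \<Longrightarrow> \<phi> (\<lambda>x. \<Sum>i\<in>I. f i x) = (\<Sum>i\<in>I. \<phi> (f i))"
proof (induction I rule: infinite_finite_induct)
  case (insert i I)
  then have "\<phi> (\<lambda>x. f i x + (\<Sum>i\<in>I. f i x)) = \<phi> (f i) + \<phi> (\<lambda>x. \<Sum>i\<in>I. f i x)"
    by (intro spectrum_add[OF phi] subalgebra_sum[OF A]) auto
  then show ?case using insert by simp
qed (simp_all add: spectrum_const)

text \<open>If the bound failed, \<open>g = f / \<phi> f\<close> would have norm below 1 while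
  \<open>\<phi> g = 1\<close>. The inverse \<open>h\<close> of \<open>1 - g\<close> satisfies
  \<open>h = 1 + g * h\<close>, and applying \<open>\<phi>\<close> gives
  \<open>\<phi> h = 1 + \<phi> h\<close>.\<close>

lemma spectrum_norm_le:
  assumes f: "f \<in> A" "\<And>x. norm (f x) \<le> b"
  shows "norm (\<phi> f) \<le> b"
proof (rule ccontr)
  assume "\<not> ?thesis"
  then have b: "b < norm (\<phi> f)" by simp
  have "0 \<le> b" using order_trans[OF norm_ge_zero f(2)] .
  then have nz: "\<phi> f \<noteq> 0" using b by auto
  define g where "g = (\<lambda>x. inverse (\<phi> f) * f x)"
  have g: "g \<in> A" unfolding g_def using f(1) by (rule subalgebra_scale[OF A])
  have r: "norm (g x) \<le> b / norm (\<phi> f)" "b / norm (\<phi> f) < 1" for x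
    using f(2)[of x] b nz
    by (auto simp: g_def norm_mult norm_inverse norm_divide divide_inverse_commute[symmetric] intro: divide_right_mono)
  define h where "h = (\<lambda>x. 1 / (1 - g x))"
  have h: "h \<in> A" unfolding h_def using subalgebra_inverse_one_minus[OF A g r] .
  have "g x \<noteq> 1" for x using r(1)[of x] r(2) by auto
  then have "h = (\<lambda>x. 1 + g x * h x)" by (auto simp: h_def fun_eq_iff field_simps)
  then have "\<phi> h = \<phi> (\<lambda>x. 1 + g x * h x)" by simp
  also have "\<dots> = 1 + \<phi> g * \<phi> h"
    using g h by (simp add: spectrum_add[OF phi] spectrum_mult[OF phi] spectrum_const
        subalgebra_const[OF A] subalgebra_mult[OF A])
  also have "\<phi> g = 1"
    unfolding g_def using spectrum_scale[OF phi f(1)] nz by simp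
  finally show False by simp
qed

text \<open>The norm bound is applied to \<open>f + t\<close> for large real \<open>t\<close>: after
  squaring, the terms \<open>t\<^sup>2\<close> cancel and the part linear in \<open>t\<close>
  compares the real parts. Geometrically, a half plane is exhausted by large discs.\<close>

lemma spectrum_Re_le:
  assumes K: "compact (UNIV :: 'a set)" and f: "f \<in> A" "\<And>x. Re (f x) \<le> s"
  shows "Re (\<phi> f) \<le> s"
proof (rule ccontr)
  assume "\<not> ?thesis"
  then have s: "s < Re (\<phi> f)" by simp
  obtain B where B: "B > 0" "\<And>x. norm (f x) \<le> B"
    using compact_bounded_function[OF K subalgebra_continuous[OF A f(1)]] by metis
  have le: "2 * t * (Re (\<phi> f) - s) \<le> B\<^sup>2" if t: "t > 0" for t
  proof -
    define R where "R = B\<^sup>2 + 2 * t * s + t\<^sup>2"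
    have ineq: "(norm (f x + of_real t))\<^sup>2 \<le> R" for x
    proof -
      have "(norm (f x + of_real t))\<^sup>2 = (norm (f x))\<^sup>2 + 2 * t * Re (f x) + t\<^sup>2"
        by (simp add: cmod_power2 power2_sum algebra_simps)
      also have "\<dots> \<le> R"
        unfolding R_def using B(2)[of x] f(2)[of x] t
        by (intro add_mono power_mono mult_left_mono) auto
      finally show ?thesis .
    qed
    have "norm (\<phi> (\<lambda>x. f x + of_real t)) \<le> sqrt R"
      using ineq by (intro spectrum_norm_le subalgebra_add[OF A] subalgebra_const[OF A] f(1) real_le_rsqrt)
    then have "norm (\<phi> f + of_real t) \<le> sqrt R"
      by (simp add: spectrum_add[OF phi f(1) subalgebra_const[OF A]] spectrum_const)
    moreover have "0 \<le> R" using order_trans[OF zero_le_power2 ineq] .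
    ultimately have "(norm (\<phi> f + of_real t))\<^sup>2 \<le> R"
      by (metis norm_ge_zero power_mono real_sqrt_pow2)
    moreover have "(Re (\<phi> f) + t)\<^sup>2 \<le> (norm (\<phi> f + of_real t))\<^sup>2"
      by (simp add: cmod_power2)
    ultimately have "(Re (\<phi> f))\<^sup>2 + 2 * t * Re (\<phi> f) \<le> B\<^sup>2 + 2 * t * s"
      by (simp add: R_def power2_sum algebra_simps)
    moreover have "0 \<le> (Re (\<phi> f))\<^sup>2" by simp
    ultimately have "2 * t * Re (\<phi> f) \<le> B\<^sup>2 + 2 * t * s" by linarith
    then show ?thesis by (simp add: algebra_simps)
  qed
  \<comment> \<open>Chosen so that the left-hand side of \<open>le\<close> becomes
    \<open>B\<^sup>2 + 1\<close>.\<close>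
  define t where "t = (B\<^sup>2 + 1) / (2 * (Re (\<phi> f) - s))"
  have "2 * t * (Re (\<phi> f) - s) = B\<^sup>2 + 1" using s by (simp add: t_def field_simps)
  moreover have "t > 0" using s by (auto simp: t_def intro!: divide_pos_pos add_nonneg_pos)
  ultimately show False using le[of t] by simp
qed

end

text \<open>The majorant \<open>p\<close> is the supremum, not the norm:
  \<open>L u \<le> p u\<close> at a nonpositive \<open>u\<close> is already positivity of
  \<open>L\<close>. The prescribed values are given as a relation between real parts, which avoids
  checking beforehand that \<open>Re (\<phi> f)\<close> is determined by the real part of
  \<open>f\<close>.\<close>

theorem spectrum_representing_measure:
  fixes A :: "('a::t2_space \<Rightarrow> complex) set"
  assumes K: "compact (UNIV :: 'a set)" and A: "closed_unital_subalgebra A" and phi: "\<phi> \<in> spectrum A"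
  obtains m where "regular_borel_measure_on UNIV m" "emeasure m UNIV = 1"
    "\<And>f. f \<in> A \<Longrightarrow> (\<integral>x. f x \<partial>m) = \<phi> f"
proof -
  define p where "p u = (SUP x. apply_bcontfun u x)" for u :: "'a \<Rightarrow>\<^sub>C real"
  have bdd: "bdd_above (range (apply_bcontfun u))" for u :: "'a \<Rightarrow>\<^sub>C real"
    by (intro bounded_imp_bdd_above) simp
  have upper: "apply_bcontfun u x \<le> p u" for u x
    unfolding p_def by (intro cSUP_upper bdd) simp
  have least: "p u \<le> c" if "\<And>x. apply_bcontfun u x \<le> c" for u c
    unfolding p_def using that by (intro cSUP_least) auto
  have p: "sublinear p"
    by (intro sublinearI least) (auto intro!: add_mono upper mult_left_mono)
  define S where "S = {(u :: 'a \<Rightarrow>\<^sub>C real, t). \<exists>f\<in>A. (\<forall>x. u x = Re (f x)) \<and> t = Re (\<phi> f)}"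
  have "subspace S"
  proof (rule subspaceI)
    show "0 \<in> S" unfolding S_def zero_prod_def
      using subalgebra_const[OF A, of 0] spectrum_const[OF A phi, of 0]
      by (auto intro!: bexI[of _ "\<lambda>x. 0"])
  next
    fix v w assume "v \<in> S" "w \<in> S"
    then obtain f g where "f \<in> A" "\<forall>x. fst v x = Re (f x)" "snd v = Re (\<phi> f)"
      "g \<in> A" "\<forall>x. fst w x = Re (g x)" "snd w = Re (\<phi> g)"
      by (auto simp: S_def)
    then show "v + w \<in> S"
      unfolding S_def plus_prod_def using spectrum_add[OF phi, of f g] subalgebra_add[OF A, of f g]
      by (auto intro!: bexI[of _ "\<lambda>x. f x + g x"])
  next
    fix c :: real and v assume "v \<in> S"
    then obtain f where "f \<in> A" "\<forall>x. fst v x = Re (f x)" "snd v = Re (\<phi> f)"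
      by (auto simp: S_def)
    then show "c *\<^sub>R v \<in> S"
      unfolding S_def scaleR_prod_def
      using spectrum_scale[OF phi, of f "of_real c"] subalgebra_scale[OF A, of f "of_real c"]
      by (auto intro!: bexI[of _ "\<lambda>x. of_real c * f x"])
  qed
  moreover have "t \<le> p u" if "(u, t) \<in> S" for u t
    using that upper[of u] by (auto simp: S_def intro!: spectrum_Re_le[OF A phi K])
  ultimately obtain L where L: "linear L" "\<And>u. L u \<le> p u" "\<And>u t. (u, t) \<in> S \<Longrightarrow> L u = t"
    using Hahn_Banach[OF p] by metis
  define I where "I u = L (Bcontfun u)" for u
  note Bcontfun_apply [simp] = Bcontfun_inverse_compact[OF K]
  have I_Re: "I (\<lambda>x. Re (f x)) = Re (\<phi> f)" if f: "f \<in> A" for f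
    using f subalgebra_continuous[OF A f] unfolding I_def
    by (intro L(3)) (auto simp: S_def continuous_intros)
  interpret I: positive_functional I
  proof
    show "compact (UNIV :: 'a set)" by (rule K)
    fix f g :: "'a \<Rightarrow> real" and c :: real assume f: "continuous_on UNIV f"
    show "I (\<lambda>x. c * f x) = c * I f"
    proof -
      have "Bcontfun (\<lambda>x. c * f x) = c *\<^sub>R Bcontfun f"
        using f by (intro bcontfun_eqI) (simp add: continuous_intros)
      then show ?thesis by (simp add: I_def linear_scale[OF L(1)])
    qed
    show "0 \<le> I f" if "\<And>x. 0 \<le> f x"
    proof -
      have "L (- Bcontfun f) \<le> 0"
        using that f by (intro order_trans[OF L(2)] least) simp
      then show ?thesis by (simp add: I_def linear_neg[OF L(1)])
    qed
    assume g: "continuous_on UNIV g"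
    have "Bcontfun (\<lambda>x. f x + g x) = Bcontfun f + Bcontfun g"
      using f g by (intro bcontfun_eqI) (simp add: continuous_intros)
    then show "I (\<lambda>x. f x + g x) = I f + I g"
      by (simp add: I_def linear_add[OF L(1)])
  next
    show "I (\<lambda>x. 1) = 1"
      using I_Re[OF subalgebra_const[OF A, of 1]] spectrum_const[OF A phi, of 1] by simp
  qed
  let ?m = "I.riesz_measure"
  show thesis
  proof (rule that)
    show "regular_borel_measure_on UNIV ?m" by (rule I.regular_riesz_measure)
    show "emeasure ?m UNIV = 1" by (rule I.emeasure_riesz_measure_UNIV)
    fix f assume f: "f \<in> A"
    have int: "integrable ?m f"
      using I.finite_measure_riesz_measure I.sets_riesz_measure subalgebra_continuous[OF A f]
      by (intro integrable_continuous_compact[OF K, of _ UNIV]) auto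
    have re: "(\<integral>x. Re (g x) \<partial>?m) = Re (\<phi> g)" if "g \<in> A" for g
      using I.integral_riesz_measure[of "\<lambda>x. Re (g x)"] I_Re[OF that]
        subalgebra_continuous[OF A that] by (simp add: continuous_intros)
    show "(\<integral>x. f x \<partial>?m) = \<phi> f"
    proof (rule complex_eqI)
      show "Re (\<integral>x. f x \<partial>?m) = Re (\<phi> f)"
        using re[OF f] int by simp
      \<comment> \<open>The imaginary part of \<open>f\<close> is the real part of
        \<open>- \<i> * f\<close>, and \<open>A\<close> is closed under this multiplication.\<close>
      show "Im (\<integral>x. f x \<partial>?m) = Im (\<phi> f)"
        using re[OF subalgebra_scale[OF A f, of "- \<i>"]] int spectrum_scale[OF phi f, of "- \<i>"] by simp
    qed
  qed
qed

subsection \<open>Maximal ideals and the Gelfand--Mazur theorem\<close>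

lemma infdist_greatest:
  assumes "M \<noteq> {}" "\<And>a. a \<in> M \<Longrightarrow> d \<le> dist x a"
  shows "d \<le> infdist x M"
  using assms by (auto simp: infdist_notempty intro: cINF_greatest)

text \<open>For an ideal, this distance is the quotient seminorm. Its sublinearity gives the
  triangle inequality and lets it serve as a Hahn-Banach majorant.\<close>

lemma sublinear_infdist:
  assumes M: "subspace (M :: 'a::real_normed_vector set)"
  shows "sublinear (\<lambda>u. infdist u M)"
proof (rule sublinearI)
  have ne: "M \<noteq> {}" using subspace_0[OF M] by auto
  fix u v :: 'a
  have "infdist (u + v) M - dist u a \<le> dist v b" if "a \<in> M" "b \<in> M" for a b
    using infdist_le[OF subspace_add[OF M that], of "u + v"] norm_triangle_ineq[of "u - a" "v - b"]
    by (simp add: dist_norm algebra_simps)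
  then have "infdist (u + v) M - dist u a \<le> infdist v M" if "a \<in> M" for a
    using that by (intro infdist_greatest ne) auto
  then have "infdist (u + v) M - infdist v M \<le> infdist u M"
    by (intro infdist_greatest ne) (simp add: algebra_simps)
  then show "infdist (u + v) M \<le> infdist u M + infdist v M" by simp
next
  have ne: "M \<noteq> {}" using subspace_0[OF M] by auto
  fix c :: real and u :: 'a assume c: "0 < c"
  have "infdist (c *\<^sub>R u) M / c \<le> infdist u M"
  proof (rule infdist_greatest[OF ne])
    fix a assume "a \<in> M"
    then have "infdist (c *\<^sub>R u) M \<le> dist (c *\<^sub>R u) (c *\<^sub>R a)"
      by (intro infdist_le subspace_scale[OF M])
    also have "\<dots> = c * dist u a"
      using c by (simp add: dist_norm flip: scaleR_diff_right)
    finally show "infdist (c *\<^sub>R u) M / c \<le> dist u a"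
      using c by (simp add: field_simps)
  qed
  then show "infdist (c *\<^sub>R u) M \<le> c * infdist u M" using c by (simp add: field_simps)
qed

lemma infdist_minus:
  assumes M: "subspace (M :: 'a::real_normed_vector set)"
  shows "infdist (- u) M = infdist u M"
proof -
  have ne: "M \<noteq> {}" using subspace_0[OF M] by auto
  have le: "infdist (- u) M \<le> infdist u M" for u
  proof (rule infdist_greatest[OF ne])
    fix a assume "a \<in> M"
    then have "infdist (- u) M \<le> dist (- u) (- a)"
      by (intro infdist_le subspace_neg[OF M])
    then show "infdist (- u) M \<le> dist u a" by (simp add: dist_minus)
  qed
  show ?thesis using le[of u] le[of "- u"] by simp
qed

section \<open>Proper and maximal ideals\<close>

definition proper_ideal :: "('a \<Rightarrow> complex) set \<Rightarrow> ('a \<Rightarrow> complex) set \<Rightarrow> bool" where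
  "proper_ideal A J \<longleftrightarrow> J \<subseteq> A \<and> (\<lambda>x. 0) \<in> J \<and> (\<lambda>x. 1) \<notin> J \<and>
     (\<forall>f\<in>J. \<forall>g\<in>J. (\<lambda>x. f x + g x) \<in> J) \<and> (\<forall>a\<in>A. \<forall>f\<in>J. (\<lambda>x. a x * f x) \<in> J)"

definition maximal_ideal :: "('a \<Rightarrow> complex) set \<Rightarrow> ('a \<Rightarrow> complex) set \<Rightarrow> bool" where
  "maximal_ideal A J \<longleftrightarrow> proper_ideal A J \<and> (\<forall>J'. proper_ideal A J' \<longrightarrow> J \<subseteq> J' \<longrightarrow> J' = J)"

lemma proper_ideal_add: "proper_ideal A J \<Longrightarrow> f \<in> J \<Longrightarrow> g \<in> J \<Longrightarrow> (\<lambda>x. f x + g x) \<in> J"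
  and proper_ideal_mult: "proper_ideal A J \<Longrightarrow> a \<in> A \<Longrightarrow> f \<in> J \<Longrightarrow> (\<lambda>x. a x * f x) \<in> J"
  and proper_ideal_0: "proper_ideal A J \<Longrightarrow> (\<lambda>x. 0) \<in> J"
  and proper_ideal_1: "proper_ideal A J \<Longrightarrow> (\<lambda>x. 1) \<notin> J"
  and proper_ideal_subset: "proper_ideal A J \<Longrightarrow> f \<in> J \<Longrightarrow> f \<in> A"
  by (auto simp: proper_ideal_def)

text \<open>Properness survives unions of chains because it says that one particular function, the
  constant 1, is not a member.\<close>

lemma proper_ideal_extend_maximal:
  assumes J: "proper_ideal A J"
  obtains m where "J \<subseteq> m" "maximal_ideal A m"
proof -
  let ?S = "{m. J \<subseteq> m \<and> proper_ideal A m}"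
  have "\<exists>m\<in>?S. \<forall>m'\<in>?S. m \<subseteq> m' \<longrightarrow> m' = m"
  proof (rule subset_Zorn_nonempty)
    show "?S \<noteq> {}" using J by auto
    fix C assume ne: "C \<noteq> {}" and ch: "subset.chain ?S C"
    then have C: "\<And>m. m \<in> C \<Longrightarrow> J \<subseteq> m \<and> proper_ideal A m"
      and tot: "\<And>m m'. m \<in> C \<Longrightarrow> m' \<in> C \<Longrightarrow> m \<subseteq> m' \<or> m' \<subseteq> m"
      by (auto simp: subset_chain_def)
    obtain m0 where m0: "m0 \<in> C" using ne by auto
    have "(\<lambda>x. f x + g x) \<in> \<Union>C" if fg: "f \<in> \<Union>C" "g \<in> \<Union>C" for f g
    proof -
      obtain m where "m \<in> C" "f \<in> m" "g \<in> m" using fg tot by blast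
      then show ?thesis using C proper_ideal_add by blast
    qed
    moreover have "(\<lambda>x. a x * f x) \<in> \<Union>C" if "a \<in> A" "f \<in> \<Union>C" for a f
      using C that proper_ideal_mult by blast
    moreover have "\<Union>C \<subseteq> A" using C proper_ideal_subset by blast
    moreover have "(\<lambda>x. 0) \<in> \<Union>C" using C[OF m0] m0 by (auto simp: proper_ideal_def)
    moreover have "(\<lambda>x. 1) \<notin> \<Union>C" using C by (auto simp: proper_ideal_def)
    ultimately have "proper_ideal A (\<Union>C)"
      by (simp only: proper_ideal_def) simp
    moreover have "J \<subseteq> \<Union>C" using C m0 by blast
    ultimately show "\<Union>C \<in> ?S" by blast
  qed
  then obtain m where m: "m \<in> ?S" "\<forall>m'\<in>?S. m \<subseteq> m' \<longrightarrow> m' = m" by (rule bexE)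
  have "maximal_ideal A m"
    unfolding maximal_ideal_def
  proof (intro conjI allI impI)
    fix m' assume "proper_ideal A m'" "m \<subseteq> m'"
    then have "m' \<in> ?S" using m(1) by auto
    then show "m' = m" using m(2) \<open>m \<subseteq> m'\<close> by simp
  qed (use m(1) in simp)
  then show thesis using m(1) by (intro that[of m]) simp_all
qed

context
  fixes A :: "('a::topological_space \<Rightarrow> complex) set" and J :: "('a \<Rightarrow> complex) set"
  assumes A: "closed_unital_subalgebra A" and J: "proper_ideal A J"
begin

lemma proper_ideal_scale: "f \<in> J \<Longrightarrow> (\<lambda>x. c * f x) \<in> J"
  using proper_ideal_mult[OF J subalgebra_const[OF A]] .

lemma proper_ideal_diff: "f \<in> J \<Longrightarrow> g \<in> J \<Longrightarrow> (\<lambda>x. f x - g x) \<in> J"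
  using proper_ideal_add[OF J, of f "\<lambda>x. (-1) * g x"] proper_ideal_scale[of g "-1"] by simp

lemma proper_ideal_continuous: "f \<in> J \<Longrightarrow> continuous_on UNIV f"
  by (rule subalgebra_continuous[OF A proper_ideal_subset[OF J]])

end

section \<open>The quotient seminorm modulo an ideal\<close>

context
  fixes A :: "('a::topological_space \<Rightarrow> complex) set" and J :: "('a \<Rightarrow> complex) set"
  assumes K: "compact (UNIV :: 'a set)" and A: "closed_unital_subalgebra A"
    and J: "proper_ideal A J"
begin

text \<open>\<open>Bcontfun\<close> moves functions into the type that carries the sup-norm. Working
  with a seminorm on functions keeps congruence modulo \<open>J\<close> explicit instead of forming
  a quotient algebra.\<close>

definition quotient_norm :: "('a \<Rightarrow> complex) \<Rightarrow> real" where
  "quotient_norm f = infdist (Bcontfun f) (Bcontfun ` J)"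

lemma subspace_Bcontfun_ideal: "subspace (Bcontfun ` J)"
proof (rule subspaceI)
  have "Bcontfun (\<lambda>x :: 'a. 0 :: complex) = 0"
    by (intro bcontfun_eqI) (simp add: Bcontfun_inverse_compact[OF K])
  then show "0 \<in> Bcontfun ` J" using proper_ideal_0[OF J] by force
next
  fix u v assume "u \<in> Bcontfun ` J" "v \<in> Bcontfun ` J"
  then obtain f g where fg: "f \<in> J" "g \<in> J" "u = Bcontfun f" "v = Bcontfun g" by auto
  then have "u + v = Bcontfun (\<lambda>x. f x + g x)"
    using proper_ideal_continuous[OF A J]
    by (intro bcontfun_eqI) (simp add: Bcontfun_inverse_compact[OF K] continuous_intros)
  then show "u + v \<in> Bcontfun ` J" using fg proper_ideal_add[OF J] by auto
next
  fix c :: real and u assume "u \<in> Bcontfun ` J"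
  then obtain f where f: "f \<in> J" "u = Bcontfun f" by auto
  then have "c *\<^sub>R u = Bcontfun (\<lambda>x. of_real c * f x)"
    using proper_ideal_continuous[OF A J]
    by (intro bcontfun_eqI)
      (simp add: Bcontfun_inverse_compact[OF K] continuous_intros scaleR_conv_of_real)
  then show "c *\<^sub>R u \<in> Bcontfun ` J" using f proper_ideal_scale[OF A J] by auto
qed

lemma quotient_norm_nonneg: "0 \<le> quotient_norm f"
  by (simp add: quotient_norm_def infdist_nonneg)

lemma quotient_norm_le:
  assumes "f \<in> A" "w \<in> J" "\<And>x. norm (f x - w x) \<le> b"
  shows "quotient_norm f \<le> b"
proof -
  have "quotient_norm f \<le> dist (Bcontfun f) (Bcontfun w)"
    unfolding quotient_norm_def using assms by (intro infdist_le) auto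
  also have "\<dots> \<le> b"
    using assms subalgebra_continuous[OF A assms(1)] proper_ideal_continuous[OF A J assms(2)]
    by (intro dist_bound) (simp add: Bcontfun_inverse_compact[OF K] dist_norm)
  finally show ?thesis .
qed

lemma quotient_norm_greatest:
  assumes "f \<in> A" "\<And>w b. w \<in> J \<Longrightarrow> (\<And>x. norm (f x - w x) \<le> b) \<Longrightarrow> d \<le> b"
  shows "d \<le> quotient_norm f"
  unfolding quotient_norm_def
proof (rule infdist_greatest)
  show "Bcontfun ` J \<noteq> {}" using proper_ideal_0[OF J] by auto
  fix u assume "u \<in> Bcontfun ` J"
  then obtain w where w: "w \<in> J" "u = Bcontfun w" by auto
  have "norm (f x - w x) \<le> dist (Bcontfun f) u" for x
    using dist_bounded[of "Bcontfun f" x u] w subalgebra_continuous[OF A assms(1)]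
      proper_ideal_continuous[OF A J w(1)]
    by (simp add: Bcontfun_inverse_compact[OF K] dist_norm)
  then show "d \<le> dist (Bcontfun f) u" using assms(2)[OF w(1)] by blast
qed

lemma quotient_norm_ideal: "f \<in> J \<Longrightarrow> quotient_norm f = 0"
  using quotient_norm_le[of f f 0] quotient_norm_nonneg[of f] proper_ideal_subset[OF J] by simp

lemma quotient_norm_add:
  assumes "f \<in> A" "g \<in> A"
  shows "quotient_norm (\<lambda>x. f x + g x) \<le> quotient_norm f + quotient_norm g"
proof -
  have "Bcontfun (\<lambda>x. f x + g x) = Bcontfun f + Bcontfun g"
    using assms[THEN subalgebra_continuous[OF A]]
    by (intro bcontfun_eqI) (simp add: Bcontfun_inverse_compact[OF K] continuous_intros)
  then show ?thesis
    using sublinear_add[OF sublinear_infdist[OF subspace_Bcontfun_ideal]]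
    by (simp add: quotient_norm_def)
qed

lemma quotient_norm_mult:
  assumes f: "f \<in> A" and g: "g \<in> A" and B: "\<And>x. norm (f x) \<le> B"
  shows "quotient_norm (\<lambda>x. f x * g x) \<le> B * quotient_norm g"
proof -
  have B0: "0 \<le> B" using order_trans[OF norm_ge_zero B] .
  have le: "quotient_norm (\<lambda>x. f x * g x) \<le> B * b"
    if w: "w \<in> J" "\<And>x. norm (g x - w x) \<le> b" for w b
  proof (rule quotient_norm_le)
    show "(\<lambda>x. f x * g x) \<in> A" "(\<lambda>x. f x * w x) \<in> J"
      using f g w by (auto intro: subalgebra_mult[OF A] proper_ideal_mult[OF J])
    show "norm (f x * g x - f x * w x) \<le> B * b" for x
      using mult_mono[OF B[of x] w(2)[of x]] B0
      by (simp add: right_diff_distrib[symmetric] norm_mult)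
  qed
  show ?thesis
  proof (cases "B = 0")
    case True
    have "quotient_norm (\<lambda>x. f x * g x) \<le> 0"
      using B True by (intro quotient_norm_le[OF subalgebra_mult[OF A f g] proper_ideal_0[OF J]])
        (simp add: norm_mult)
    then show ?thesis using True by simp
  next
    case False
    have "quotient_norm (\<lambda>x. f x * g x) / B \<le> quotient_norm g"
      using le False B0 by (intro quotient_norm_greatest[OF g]) (auto simp: field_simps)
    then show ?thesis using False B0 by (simp add: field_simps)
  qed
qed

lemma quotient_norm_scale:
  "g \<in> A \<Longrightarrow> quotient_norm (\<lambda>x. c * g x) \<le> norm c * quotient_norm g"
  by (rule quotient_norm_mult[OF subalgebra_const[OF A]]) auto

lemma quotient_norm_cong:
  assumes "f \<in> A" "g \<in> A" "(\<lambda>x. f x - g x) \<in> J"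
  shows "quotient_norm f \<le> quotient_norm g"
  using quotient_norm_add[OF subalgebra_diff[OF A assms(1,2)] assms(2)]
    quotient_norm_ideal[OF assms(3)] by simp

text \<open>An element of \<open>J\<close> at distance less than 1 from the constant 1 would be
  invertible in \<open>A\<close> by the Neumann series, which would put 1 into
  \<open>J\<close>.\<close>

lemma quotient_norm_1: "1 \<le> quotient_norm (\<lambda>x. 1)"
proof (rule quotient_norm_greatest[OF subalgebra_const[OF A]], rule ccontr)
  fix w b assume w: "w \<in> J" and b: "\<And>x. norm (1 - w x) \<le> b" and "\<not> 1 \<le> b"
  then have "w x \<noteq> 0" for x using b[of x] by (metis diff_zero norm_one)
  have "(\<lambda>x. 1 / (1 - (1 - w x))) \<in> A"
    using b \<open>\<not> 1 \<le> b\<close> proper_ideal_subset[OF J w] subalgebra_const[OF A]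
    by (intro subalgebra_inverse_one_minus[OF A, of _ b] subalgebra_diff[OF A]) auto
  then have "(\<lambda>x. 1 / w x * w x) \<in> J"
    using proper_ideal_mult[OF J _ w, of "\<lambda>x. 1 / w x"] by simp
  moreover have "(\<lambda>x. 1 / w x * w x) = (\<lambda>x. 1)"
    using \<open>\<And>x. w x \<noteq> 0\<close> by (simp add: fun_eq_iff)
  ultimately show False using proper_ideal_1[OF J] by simp
qed

text \<open>A real functional is extended from the line through \<open>a\<close> under the distance
  to \<open>J\<close>, then made complex linear. Domination by the quotient seminorm makes it vanish
  on \<open>J\<close>; the factor 2 comes from bounding real and imaginary parts separately.\<close>

lemma quotient_functional:
  assumes a: "a \<in> A" "0 < quotient_norm a"
  obtains F where "\<And>f g. f \<in> A \<Longrightarrow> g \<in> A \<Longrightarrow> F (\<lambda>x. f x + g x) = F f + F g"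
    "\<And>c f. f \<in> A \<Longrightarrow> F (\<lambda>x. c * f x) = c * F f"
    "\<And>f. f \<in> A \<Longrightarrow> norm (F f) \<le> 2 * quotient_norm f" "F a \<noteq> 0"
proof -
  let ?p = "\<lambda>u. infdist u (Bcontfun ` J)"
  have p: "sublinear ?p" by (rule sublinear_infdist[OF subspace_Bcontfun_ideal])
  note Bcontfun_apply [simp] = Bcontfun_inverse_compact[OF K]
  define S where "S = (\<lambda>t. (t *\<^sub>R Bcontfun a, t * quotient_norm a)) ` UNIV"
  have "linear (\<lambda>t. (t *\<^sub>R Bcontfun a, t * quotient_norm a))"
    by (intro linearI) (auto simp: algebra_simps)
  then have "subspace S" unfolding S_def by (intro linear_subspace_image subspace_UNIV)
  moreover have "t \<le> ?p u" if ut: "(u, t) \<in> S" for u t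
  proof -
    obtain s where s: "u = s *\<^sub>R Bcontfun a" "t = s * quotient_norm a" using ut by (auto simp: S_def)
    show ?thesis
    proof (cases "s \<ge> 0")
      case True
      then show ?thesis using sublinear_scaleR[OF p True, of "Bcontfun a"] s
        by (simp add: quotient_norm_def)
    next
      case False
      then have "t \<le> 0" using s a by (simp add: mult_nonpos_nonneg)
      then show ?thesis using infdist_nonneg order_trans by blast
    qed
  qed
  ultimately obtain L where L: "linear L" "\<And>u. L u \<le> ?p u" "\<And>u t. (u, t) \<in> S \<Longrightarrow> L u = t"
    using Hahn_Banach[OF p] by metis
  have La: "L (Bcontfun a) = quotient_norm a"
    by (intro L(3)) (auto simp: S_def intro!: image_eqI[of _ _ 1])
  define l where "l f = L (Bcontfun f)" for f
  have l_add: "l (\<lambda>x. f x + g x) = l f + l g" if "f \<in> A" "g \<in> A" for f g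
  proof -
    have "Bcontfun (\<lambda>x. f x + g x) = Bcontfun f + Bcontfun g"
      using that[THEN subalgebra_continuous[OF A]]
      by (intro bcontfun_eqI) (simp add: continuous_intros)
    then show ?thesis by (simp add: l_def linear_add[OF L(1)])
  qed
  have l_scale: "l (\<lambda>x. of_real c * f x) = c * l f" if "f \<in> A" for c f
  proof -
    have "Bcontfun (\<lambda>x. of_real c * f x) = c *\<^sub>R Bcontfun f"
      using that[THEN subalgebra_continuous[OF A]]
      by (intro bcontfun_eqI) (simp add: continuous_intros scaleR_conv_of_real)
    then show ?thesis by (simp add: l_def linear_scale[OF L(1)])
  qed
  have l_bound: "\<bar>l f\<bar> \<le> quotient_norm f" for f
    using L(2)[of "Bcontfun f"] L(2)[of "- Bcontfun f"]
    by (simp add: l_def quotient_norm_def linear_neg[OF L(1)] infdist_minus[OF subspace_Bcontfun_ideal])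
  \<comment> \<open>The usual complexification \<open>l f - \<i> * l (\<i> * f)\<close> of a real
    linear functional.\<close>
  define F where "F f = Complex (l f) (- l (\<lambda>x. \<i> * f x))" for f
  show thesis
  proof (rule that[of F])
    show F_add: "F (\<lambda>x. f x + g x) = F f + F g" if "f \<in> A" "g \<in> A" for f g
      using l_add[OF that] l_add[OF subalgebra_scale[OF A that(1), of \<i>] subalgebra_scale[OF A that(2), of \<i>]]
      by (simp add: F_def complex_eq_iff algebra_simps)
    have F_real: "F (\<lambda>x. of_real c * f x) = of_real c * F f" if "f \<in> A" for c f
      using l_scale[OF that, of c] l_scale[OF subalgebra_scale[OF A that], of c \<i>]
      by (simp add: F_def complex_eq_iff mult.left_commute)
    have F_i: "F (\<lambda>x. \<i> * f x) = \<i> * F f" if "f \<in> A" for f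
      using l_scale[OF that, of "-1"]
      by (simp add: F_def complex_eq_iff mult.assoc[symmetric])
    show "F (\<lambda>x. c * f x) = c * F f" if f: "f \<in> A" for c f
    proof -
      have "c = of_real (Re c) + of_real (Im c) * \<i>"
        using complex_eq[of c] by (simp add: mult.commute)
      then have c: "c * y = of_real (Re c) * y + of_real (Im c) * (\<i> * y)" for y
        by (metis distrib_right mult.assoc)
      have "F (\<lambda>x. c * f x) = of_real (Re c) * F f + of_real (Im c) * (\<i> * F f)"
        using f by (simp add: c F_add F_real F_i subalgebra_scale[OF A])
      also have "\<dots> = c * F f" by (rule c[symmetric])
      finally show ?thesis .
    qed
    show "norm (F f) \<le> 2 * quotient_norm f" if f: "f \<in> A" for f
    proof -
      have "norm (F f) \<le> \<bar>l f\<bar> + \<bar>l (\<lambda>x. \<i> * f x)\<bar>"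
        using cmod_le[of "F f"] by (simp add: F_def)
      also have "\<dots> \<le> quotient_norm f + quotient_norm (\<lambda>x. \<i> * f x)"
        by (intro add_mono l_bound)
      also have "\<dots> \<le> quotient_norm f + norm \<i> * quotient_norm f"
        by (intro add_left_mono quotient_norm_scale f)
      finally show ?thesis by simp
    qed
    show "F a \<noteq> 0" using La a(2) by (simp add: F_def l_def complex_eq_iff)
  qed
qed

end

text \<open>The sum of \<open>m\<close> and the principal ideal of \<open>f\<close> is strictly
  larger than \<open>m\<close>, so by maximality it contains 1.\<close>

lemma maximal_ideal_inverse:
  assumes A: "closed_unital_subalgebra A" and m: "maximal_ideal A m" and f: "f \<in> A" "f \<notin> m"
  obtains a where "a \<in> A" "(\<lambda>x. f x * a x - 1) \<in> m"
proof -
  have pm: "proper_ideal A m" using m by (simp add: maximal_ideal_def)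
  define m' where "m' = {\<lambda>x. u x + a x * f x | u a. u \<in> m \<and> a \<in> A}"
  have m'I: "(\<lambda>x. u x + a x * f x) \<in> m'" if "u \<in> m" "a \<in> A" for u a
    using that by (auto simp: m'_def)
  have "m \<subseteq> m'" using m'I[OF _ subalgebra_const[OF A, of 0]] by auto
  moreover have "f \<in> m'" using m'I[OF proper_ideal_0[OF pm] subalgebra_const[OF A, of 1]] by simp
  ultimately have "\<not> proper_ideal A m'"
    using m f by (auto simp: maximal_ideal_def)
  moreover have "m' \<subseteq> A"
    using proper_ideal_subset[OF pm] subalgebra_mult[OF A _ f(1)] subalgebra_add[OF A]
    by (auto simp: m'_def)
  moreover have "(\<lambda>x. 0) \<in> m'" using \<open>m \<subseteq> m'\<close> proper_ideal_0[OF pm] by blast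
  moreover have "(\<lambda>x. g x + h x) \<in> m'" if gh: "g \<in> m'" "h \<in> m'" for g h
  proof -
    obtain u a v b where "g = (\<lambda>x. u x + a x * f x)" "h = (\<lambda>x. v x + b x * f x)"
      "u \<in> m" "v \<in> m" "a \<in> A" "b \<in> A" using gh by (auto simp: m'_def)
    then show ?thesis
      using m'I[OF proper_ideal_add[OF pm, of u v] subalgebra_add[OF A, of a b]]
      by (simp add: algebra_simps)
  qed
  moreover have "(\<lambda>x. b x * g x) \<in> m'" if gb: "b \<in> A" "g \<in> m'" for b g
  proof -
    obtain u a where "g = (\<lambda>x. u x + a x * f x)" "u \<in> m" "a \<in> A" using gb by (auto simp: m'_def)
    then show ?thesis
      using m'I[OF proper_ideal_mult[OF pm, of b u] subalgebra_mult[OF A, of b a]] gb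
      by (simp add: algebra_simps)
  qed
  ultimately have "(\<lambda>x. 1) \<in> m'" by (auto simp: proper_ideal_def)
  then obtain u a where ua: "(\<lambda>x. 1) = (\<lambda>x. u x + a x * f x)" "u \<in> m" "a \<in> A"
    by (auto simp: m'_def)
  then have "(\<lambda>x. f x * a x - 1) = (\<lambda>x. (-1) * u x)"
    by (auto simp: fun_eq_iff algebra_simps)
  then show thesis
    using that[OF ua(3)] proper_ideal_mult[OF pm subalgebra_const[OF A, of "-1"] ua(2)] by simp
qed

text \<open>Gelfand-Mazur: if no \<open>f - c\<close> were in \<open>m\<close>, inverses
  \<open>a c\<close> of \<open>f - c\<close> modulo \<open>m\<close> would exist for all
  \<open>c\<close>. A functional that vanishes on \<open>m\<close> turns them into an entire
  function that tends to 0 at infinity, contradicting Liouville's theorem since it is nonzero at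
  0.\<close>

theorem maximal_ideal_scalar:
  fixes A :: "('a::topological_space \<Rightarrow> complex) set"
  assumes K: "compact (UNIV :: 'a set)" and A: "closed_unital_subalgebra A"
    and m: "maximal_ideal A m" and f: "f \<in> A"
  obtains c where "(\<lambda>x. f x - c) \<in> m"
proof (rule ccontr)
  assume contra: "\<not> thesis"
  have J: "proper_ideal A m" using m by (simp add: maximal_ideal_def)
  let ?q = "quotient_norm m"
  note const = subalgebra_const[OF A] and mult = subalgebra_mult[OF A]
    and diff = subalgebra_diff[OF A] and scl = subalgebra_scale[OF A]
  have "\<exists>a\<in>A. (\<lambda>x. (f x - c) * a x - 1) \<in> m" for c
    using maximal_ideal_inverse[OF A m diff[OF f const]] contra that by metis
  then obtain a where a: "\<And>c. a c \<in> A" and inv: "\<And>c. (\<lambda>x. (f x - c) * a c x - 1) \<in> m"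
    by metis
  have "\<exists>N. \<forall>x. norm (a c x) \<le> N" for c
    using compact_bounded_function[OF K subalgebra_continuous[OF A a], of c] by metis
  then obtain N where N: "\<And>c x. norm (a c x) \<le> N c" by metis
  obtain B where B: "B > 0" "\<And>x. norm (f x) \<le> B"
    using compact_bounded_function[OF K subalgebra_continuous[OF A f]] by metis
  have N0: "0 \<le> N c" for c using order_trans[OF norm_ge_zero N] .
  have q0: "0 \<le> ?q g" for g by (rule quotient_norm_nonneg[OF K A J])
  \<comment> \<open>The resolvent identity modulo \<open>m\<close>. The \<open>a c\<close> are
    arbitrary choices, so all regularity in \<open>c\<close> has to come from it.\<close>
  have resolvent: "(\<lambda>x. (a c x - a d x) - (c - d) * (a d x * a c x)) \<in> m" for c d
  proof -
    have "(\<lambda>x. a d x * ((f x - c) * a c x - 1) - a c x * ((f x - d) * a d x - 1)) \<in> m"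
      by (intro proper_ideal_diff[OF A J] proper_ideal_mult[OF J] a inv)
    then show ?thesis by (simp add: algebra_simps)
  qed
  have q_diff: "?q (\<lambda>x. a c x - a d x) \<le> norm (c - d) * (N d * ?q (a c))" for c d
  proof -
    have "?q (\<lambda>x. a c x - a d x) \<le> ?q (\<lambda>x. (c - d) * (a d x * a c x))"
      by (intro quotient_norm_cong[OF K A J] resolvent diff scl mult a)
    also have "\<dots> \<le> norm (c - d) * ?q (\<lambda>x. a d x * a c x)"
      by (intro quotient_norm_scale[OF K A J] mult a)
    also have "\<dots> \<le> norm (c - d) * (N d * ?q (a c))"
      by (intro mult_left_mono quotient_norm_mult[OF K A J] a N) simp
    finally show ?thesis .
  qed
  \<comment> \<open>The bounds \<open>N c\<close> come from a choice and give no control as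
    \<open>c\<close> varies; this estimate bounds the seminorm of \<open>a c\<close> near
    \<open>d\<close> by data at \<open>d\<close> alone.\<close>
  have q_local: "?q (a c) \<le> 2 * ?q (a d)" if cd: "norm (c - d) * N d \<le> 1 / 2" for c d
  proof -
    have "?q (a c) \<le> ?q (\<lambda>x. a c x - a d x) + ?q (a d)"
      using quotient_norm_add[OF K A J diff[OF a a] a, of c d d] by simp
    also have "\<dots> \<le> norm (c - d) * N d * ?q (a c) + ?q (a d)"
      using q_diff[of c d] by (simp add: mult.assoc)
    also have "\<dots> \<le> 1 / 2 * ?q (a c) + ?q (a d)"
      using cd q0 by (intro add_right_mono mult_right_mono) auto
    finally show ?thesis by simp
  qed
  \<comment> \<open>Since 1 is congruent to \<open>f * a 0\<close>, its seminorm, which is at least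
    1, keeps that of \<open>a 0\<close> away from 0.\<close>
  have "?q (\<lambda>x. 1) \<le> ?q (\<lambda>x. f x * a 0 x)"
    using proper_ideal_scale[OF A J inv[of 0], of "-1"]
    by (intro quotient_norm_cong[OF K A J] const mult f a) simp
  also have "\<dots> \<le> B * ?q (a 0)"
    by (intro quotient_norm_mult[OF K A J] f a B)
  finally have "1 \<le> B * ?q (a 0)" using quotient_norm_1[OF K A J] by simp
  then have pos: "0 < ?q (a 0)" using B(1) q0[of "a 0"] by (cases "?q (a 0) = 0") auto
  obtain F where F_add: "\<And>f g. f \<in> A \<Longrightarrow> g \<in> A \<Longrightarrow> F (\<lambda>x. f x + g x) = F f + F g"
    and F_scale: "\<And>c f. f \<in> A \<Longrightarrow> F (\<lambda>x. c * f x) = c * F f"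
    and F_bound: "\<And>f. f \<in> A \<Longrightarrow> norm (F f) \<le> 2 * ?q f" and F0: "F (a 0) \<noteq> 0"
    by (rule quotient_functional[OF K A J a pos]) (rule that)
  have F_diff: "F (\<lambda>x. g x - h x) = F g - F h" if "g \<in> A" "h \<in> A" for g h
    using F_add[OF that(1) scl[OF that(2), of "-1"]] F_scale[OF that(2), of "-1"] by simp
  define \<Phi> where "\<Phi> c = F (a c)" for c
  have deriv: "(\<Phi> has_field_derivative F (\<lambda>x. a d x * a d x)) (at d)" for d
  proof -
    \<comment> \<open>One factor 2 comes from \<open>F_bound\<close>, the other from
      \<open>q_local\<close>; the two factors \<open>N d\<close> come from multiplying by
      \<open>a d\<close> twice.\<close>
    let ?C = "4 * (N d * (N d * ?q (a d)))"
    have "norm ((\<Phi> c - \<Phi> d) / (c - d) - F (\<lambda>x. a d x * a d x)) \<le> norm (c - d) * ?C"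
      if c: "c \<noteq> d" "norm (c - d) * N d \<le> 1 / 2" for c
    proof -
      have "F (\<lambda>x. (a c x - a d x) - (c - d) * (a d x * a c x)) = 0"
        using F_bound[OF proper_ideal_subset[OF J resolvent[of c d]]]
          quotient_norm_ideal[OF K A J resolvent[of c d]] by simp
      then have "\<Phi> c - \<Phi> d = (c - d) * F (\<lambda>x. a d x * a c x)"
        by (simp add: \<Phi>_def F_diff F_scale a mult diff scl)
      then have "(\<Phi> c - \<Phi> d) / (c - d) - F (\<lambda>x. a d x * a d x) = F (\<lambda>x. a d x * (a c x - a d x))"
        using c by (simp add: F_diff a mult right_diff_distrib)
      also have "norm \<dots> \<le> 2 * ?q (\<lambda>x. a d x * (a c x - a d x))"
        by (intro F_bound mult diff a)
      also have "\<dots> \<le> 2 * (N d * ?q (\<lambda>x. a c x - a d x))"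
        by (intro mult_left_mono quotient_norm_mult[OF K A J] a diff N) simp
      also have "\<dots> \<le> 2 * (N d * (norm (c - d) * (N d * ?q (a c))))"
        by (intro mult_left_mono q_diff N0) simp
      also have "\<dots> \<le> 2 * (N d * (norm (c - d) * (N d * (2 * ?q (a d)))))"
        by (intro mult_left_mono q_local c N0) auto
      finally show ?thesis by (simp add: mult_ac)
    qed
    moreover have "\<forall>\<^sub>F c in at d. c \<noteq> d \<and> norm (c - d) * N d \<le> 1 / 2"
    proof -
      have "((\<lambda>c. norm (c - d) * N d) \<longlongrightarrow> norm (d - d) * N d) (at d)"
        by (intro tendsto_intros)
      then have "\<forall>\<^sub>F c in at d. norm (c - d) * N d < 1 / 2"
        by (rule order_tendstoD) simp
      then show ?thesis
        using eventually_at_filter by (auto simp: eventually_conj_iff elim: eventually_mono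
            intro: eventually_neq_at_within)
    qed
    ultimately have "\<forall>\<^sub>F c in at d. norm ((\<Phi> c - \<Phi> d) / (c - d) - F (\<lambda>x. a d x * a d x))
        \<le> norm (c - d) * ?C"
      by (auto elim: eventually_mono)
    moreover have "((\<lambda>c. norm (c - d) * ?C) \<longlongrightarrow> 0) (at d)"
      by (rule tendsto_eq_intros | simp)+
    ultimately have "((\<lambda>c. (\<Phi> c - \<Phi> d) / (c - d) - F (\<lambda>x. a d x * a d x)) \<longlongrightarrow> 0) (at d)"
      by (rule Lim_null_comparison)
    then show ?thesis
      unfolding has_field_derivative_iff by (simp add: LIM_zero_iff)
  qed
  then have "\<Phi> holomorphic_on UNIV"
    by (auto simp: holomorphic_on_def field_differentiable_def)
  moreover have "(\<Phi> \<longlongrightarrow> 0) at_infinity"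
  proof (rule Lim_null_comparison)
    let ?D = "2 * ?q (\<lambda>x. 1)"
    have "norm (\<Phi> c) \<le> ?D / (norm c - B)" if c: "norm c > B" for c
    proof -
      have "c \<noteq> 0" using c B(1) by auto
      then have "norm c * ?q (a c) = norm c * ?q (\<lambda>x. inverse c * (c * a c x))"
        using \<open>c \<noteq> 0\<close> by (simp add: mult.assoc[symmetric])
      also have "\<dots> \<le> norm c * (norm (inverse c) * ?q (\<lambda>x. c * a c x))"
        by (intro mult_left_mono quotient_norm_scale[OF K A J] scl a) simp
      also have "\<dots> = ?q (\<lambda>x. c * a c x)"
        using \<open>c \<noteq> 0\<close> by (simp add: norm_inverse)
      \<comment> \<open>Modulo \<open>m\<close>, \<open>c * a c\<close> is congruent to
        \<open>f * a c - 1\<close>. This bounds \<open>norm c * ?q (a c)\<close> by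
        \<open>B * ?q (a c)\<close> plus a constant, whence decay of order
        \<open>1 / norm c\<close>.\<close>
      also have "\<dots> \<le> ?q (\<lambda>x. f x * a c x + (-1) * 1)"
        using proper_ideal_scale[OF A J inv[of c], of "-1"]
        by (intro quotient_norm_cong[OF K A J] subalgebra_add[OF A] const mult f a scl)
          (simp add: algebra_simps)
      also have "\<dots> \<le> ?q (\<lambda>x. f x * a c x) + ?q (\<lambda>x. (-1) * 1)"
        by (intro quotient_norm_add[OF K A J] mult const f a)
      also have "\<dots> \<le> B * ?q (a c) + norm (- 1 :: complex) * ?q (\<lambda>x. 1)"
        by (intro add_mono quotient_norm_mult[OF K A J] quotient_norm_scale[OF K A J] const f a B)
      finally have "(norm c - B) * ?q (a c) \<le> ?q (\<lambda>x. 1)"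
        by (simp add: algebra_simps)
      then have "?q (a c) \<le> ?q (\<lambda>x. 1) / (norm c - B)"
        using c by (simp add: field_simps)
      then show ?thesis using F_bound[OF a, of c] by (simp add: \<Phi>_def)
    qed
    moreover have "\<forall>\<^sub>F c :: complex in at_infinity. norm c > B"
      unfolding eventually_at_infinity by (intro exI[of _ "B + 1"]) auto
    ultimately show "\<forall>\<^sub>F c in at_infinity. norm (\<Phi> c) \<le> ?D / (norm c - B)"
      by (auto elim: eventually_mono)
    have "filterlim (\<lambda>c :: complex. norm c - B) at_top at_infinity"
      using filterlim_tendsto_add_at_top[OF tendsto_const[of "- B"] filterlim_norm_at_top] by simp
    then show "((\<lambda>c :: complex. ?D / (norm c - B)) \<longlongrightarrow> 0) at_infinity"
      by (intro tendsto_divide_0[OF tendsto_const] filterlim_at_top_imp_at_infinity)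
  qed
  ultimately have "\<Phi> 0 = 0" by (rule Liouville_weak_0)
  then show False using F0 by (simp add: \<Phi>_def)
qed

text \<open>The scalar congruent to \<open>f\<close> is unique because a nonzero constant in
  \<open>m\<close> would generate 1. The second conclusion is the form in which a value is later
  read off from membership in \<open>m\<close>.\<close>

theorem maximal_ideal_character:
  fixes A :: "('a::topological_space \<Rightarrow> complex) set"
  assumes K: "compact (UNIV :: 'a set)" and A: "closed_unital_subalgebra A" and m: "maximal_ideal A m"
  obtains \<tau> where "\<tau> \<in> spectrum A" "\<And>f c. f \<in> A \<Longrightarrow> (\<lambda>x. f x - c) \<in> m \<Longrightarrow> \<tau> f = c"
proof -
  have J: "proper_ideal A m" using m by (simp add: maximal_ideal_def)
  have uniq: "c = d" if "(\<lambda>x. f x - c) \<in> m" "(\<lambda>x. f x - d) \<in> m" for f c d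
  proof (rule ccontr)
    assume ne: "c \<noteq> d"
    have "(\<lambda>x. inverse (c - d) * ((f x - d) - (f x - c))) \<in> m"
      by (intro proper_ideal_scale[OF A J] proper_ideal_diff[OF A J] that)
    then show False using ne proper_ideal_1[OF J] by simp
  qed
  define \<tau> where "\<tau> = (\<lambda>f\<in>A. THE c. (\<lambda>x. f x - c) \<in> m)"
  have eqI: "\<tau> f = c" if "f \<in> A" "(\<lambda>x. f x - c) \<in> m" for f c
    using that uniq by (auto simp: \<tau>_def intro!: the_equality)
  have mem: "(\<lambda>x. f x - \<tau> f) \<in> m" if "f \<in> A" for f
    using maximal_ideal_scalar[OF K A m that] eqI[OF that] by metis
  have "\<tau> \<in> spectrum A"
    unfolding spectrum_def
  proof (intro CollectI conjI ballI allI)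
    show "\<tau> \<in> extensional A" by (simp add: \<tau>_def)
    fix f g assume fg: "f \<in> A" "g \<in> A"
    show "\<tau> (\<lambda>x. f x + g x) = \<tau> f + \<tau> g"
      using proper_ideal_add[OF J mem[OF fg(1)] mem[OF fg(2)]]
      by (intro eqI subalgebra_add[OF A] fg) (simp add: algebra_simps)
    \<comment> \<open>This sum equals \<open>f * g - \<tau> f * \<tau> g\<close>.\<close>
    have "(\<lambda>x. g x * (f x - \<tau> f) + \<tau> f * (g x - \<tau> g)) \<in> m"
      by (intro proper_ideal_add[OF J] proper_ideal_mult[OF J] proper_ideal_scale[OF A J] mem fg)
    then show "\<tau> (\<lambda>x. f x * g x) = \<tau> f * \<tau> g"
      by (intro eqI subalgebra_mult[OF A] fg) (simp add: algebra_simps)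
  next
    fix c f assume f: "f \<in> A"
    show "\<tau> (\<lambda>x. c * f x) = c * \<tau> f"
      using proper_ideal_scale[OF A J mem[OF f], of c]
      by (intro eqI subalgebra_scale[OF A] f) (simp add: algebra_simps)
  next
    have "\<tau> (\<lambda>x. 1) = 1"
      using proper_ideal_0[OF J] by (intro eqI subalgebra_const[OF A]) simp
    then show "\<exists>f\<in>A. \<tau> f \<noteq> 0"
      using subalgebra_const[OF A, of 1] by (intro bexI[of _ "\<lambda>x. 1"]) simp_all
  qed
  then show thesis using that eqI by blast
qed

text \<open>\<open>J\<close> is the largest ideal contained in the kernel of \<open>\<psi>\<close>
  composed with \<open>P\<close>. For \<open>k\<close> in the kernel of \<open>\<psi>\<close>,
  linearity over \<open>B\<close> gives
  \<open>\<psi> (P (a * k)) = \<psi> k * \<psi> (P a) = 0\<close>, so \<open>k\<close> lies in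
  \<open>J\<close>. The character of a maximal ideal above \<open>J\<close> then agrees with
  \<open>\<psi>\<close> on \<open>B\<close>, because each \<open>f - \<psi> f\<close> is such a
  \<open>k\<close>.\<close>

theorem spectrum_extend_of_projection:
  fixes A :: "('a::topological_space \<Rightarrow> complex) set"
  assumes K: "compact (UNIV :: 'a set)" and A: "closed_unital_subalgebra A"
    and B: "closed_unital_subalgebra B" "B \<subseteq> A"
    and P: "\<And>f. f \<in> A \<Longrightarrow> P f \<in> B" "P (\<lambda>x. 1) = (\<lambda>x. 1)"
      "\<And>f g. f \<in> A \<Longrightarrow> g \<in> A \<Longrightarrow> P (\<lambda>x. f x + g x) = (\<lambda>x. P f x + P g x)"
      "\<And>b f. b \<in> B \<Longrightarrow> f \<in> A \<Longrightarrow> P (\<lambda>x. b x * f x) = (\<lambda>x. b x * P f x)"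
    and \<psi>: "\<psi> \<in> spectrum B"
  obtains \<tau> where "\<tau> \<in> spectrum A" "\<And>f. f \<in> B \<Longrightarrow> \<tau> f = \<psi> f"
proof -
  define J where "J = {f\<in>A. \<forall>a\<in>A. \<psi> (P (\<lambda>x. a x * f x)) = 0}"
  have "proper_ideal A J"
    unfolding proper_ideal_def
  proof (intro conjI ballI)
    show "J \<subseteq> A" by (auto simp: J_def)
    have "P (\<lambda>x. 0) = (\<lambda>x. 0)"
      using P(4)[OF subalgebra_const[OF B(1), of 0] subalgebra_const[OF A, of 0]] by simp
    then show "(\<lambda>x. 0) \<in> J"
      using subalgebra_const[OF A, of 0] spectrum_const[OF B(1) \<psi>, of 0] by (simp add: J_def)
    show "(\<lambda>x. 1) \<notin> J"
    proof
      assume "(\<lambda>x. 1) \<in> J"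
      then have "\<forall>a\<in>A. \<psi> (P (\<lambda>x. a x * 1)) = 0" by (simp add: J_def)
      from bspec[OF this subalgebra_const[OF A, of 1]] have "\<psi> (P (\<lambda>x. 1)) = 0" by simp
      then show False using P(2) spectrum_const[OF B(1) \<psi>, of 1] by simp
    qed
  next
    fix f g assume fg: "f \<in> J" "g \<in> J"
    then have fgA: "f \<in> A" "g \<in> A" by (auto simp: J_def)
    have "\<psi> (P (\<lambda>x. a x * (f x + g x))) = 0" if a: "a \<in> A" for a
    proof -
      have "\<psi> (P (\<lambda>x. a x * (f x + g x))) = \<psi> (\<lambda>x. P (\<lambda>x. a x * f x) x + P (\<lambda>x. a x * g x) x)"
        using P(3)[OF subalgebra_mult[OF A a fgA(1)] subalgebra_mult[OF A a fgA(2)]]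
        by (simp add: algebra_simps)
      also have "\<dots> = \<psi> (P (\<lambda>x. a x * f x)) + \<psi> (P (\<lambda>x. a x * g x))"
        by (intro spectrum_add[OF \<psi>] P(1) subalgebra_mult[OF A] a fgA)
      finally show ?thesis using fg a by (simp add: J_def)
    qed
    then show "(\<lambda>x. f x + g x) \<in> J" using subalgebra_add[OF A fgA] by (simp add: J_def)
  next
    fix a f assume af: "a \<in> A" "f \<in> J"
    have "\<psi> (P (\<lambda>x. b x * (a x * f x))) = 0" if "b \<in> A" for b
    proof -
      have "\<forall>c\<in>A. \<psi> (P (\<lambda>x. c x * f x)) = 0" using af by (simp add: J_def)
      from bspec[OF this subalgebra_mult[OF A that af(1)]]
      have "\<psi> (P (\<lambda>x. (b x * a x) * f x)) = 0" .
      then show ?thesis by (simp add: mult.assoc)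
    qed
    then show "(\<lambda>x. a x * f x) \<in> J"
      using af subalgebra_mult[OF A, of a f] by (simp add: J_def)
  qed
  then obtain m where m: "J \<subseteq> m" "maximal_ideal A m" by (rule proper_ideal_extend_maximal)
  obtain \<tau> where \<tau>: "\<tau> \<in> spectrum A" "\<And>f c. f \<in> A \<Longrightarrow> (\<lambda>x. f x - c) \<in> m \<Longrightarrow> \<tau> f = c"
    using maximal_ideal_character[OF K A m(2)] by metis
  have "\<tau> f = \<psi> f" if f: "f \<in> B" for f
  proof -
    define k where "k = (\<lambda>x. f x - \<psi> f)"
    have k: "k \<in> B" unfolding k_def
      using f by (intro subalgebra_diff[OF B(1)] subalgebra_const[OF B(1)])
    have "\<psi> k = 0" unfolding k_def
      by (subst spectrum_diff[OF B(1) \<psi> f subalgebra_const[OF B(1)]])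
        (simp add: spectrum_const[OF B(1) \<psi>])
    then have "\<psi> (P (\<lambda>x. a x * k x)) = 0" if "a \<in> A" for a
      using P(4)[OF k that] spectrum_mult[OF \<psi> k P(1)[OF that]] by (simp add: mult.commute)
    then have "k \<in> m" using m(1) k B(2) by (auto simp: J_def)
    then show ?thesis using \<tau>(2)[of f "\<psi> f"] f B(2) by (auto simp: k_def)
  qed
  then show thesis using that \<tau>(1) by blast
qed

lemma space_restrict_borel:
  assumes "sets m = sets (restrict_space borel S)"
  shows "space m = S"
  using sets_eq_imp_space_eq[OF assms] by (simp add: space_restrict_space)

subsection \<open>Approximation of integrals and exchange of characters\<close>

lemma (in finite_measure) norm_integral_le_const:
  fixes f :: "'a \<Rightarrow> 'b::{banach, second_countable_topology}"
  assumes "integrable M f" "\<And>x. x \<in> space M \<Longrightarrow> norm (f x) \<le> e"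
  shows "norm (\<integral>x. f x \<partial>M) \<le> e * measure M (space M)"
proof -
  have "norm (\<integral>x. f x \<partial>M) \<le> (\<integral>x. norm (f x) \<partial>M)" by (rule integral_norm_bound)
  also have "\<dots> \<le> (\<integral>x. e \<partial>M)"
    using assms by (intro integral_mono integrable_norm integrable_const)
  finally show ?thesis by (simp add: mult.commute)
qed

text \<open>This class of functions is wide enough to contain every section
  \<open>\<lambda>x. F x y\<close> and, by the norm bound for characters, every
  \<open>\<lambda>x. \<psi> (F x)\<close>.\<close>

definition controlled_by :: "'a set \<Rightarrow> ('a \<Rightarrow> 'b \<Rightarrow> complex) \<Rightarrow> real \<Rightarrow> ('a \<Rightarrow> complex) \<Rightarrow> bool" where
  "controlled_by S F e u \<longleftrightarrow>
     (\<forall>s\<in>S. \<forall>t\<in>S. (\<forall>y. norm (F s y - F t y) \<le> e) \<longrightarrow> norm (u s - u t) \<le> e)"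

lemma controlled_by_section: "controlled_by S F e (\<lambda>x. F x y)"
  by (simp add: controlled_by_def)

text \<open>
  Partitioning \<open>S\<close> into finitely many pieces on which \<open>F\<close> oscillates by at most \<open>e\<close>, uniformly in
  the second variable, gives weights that work simultaneously for all functions \<open>u\<close> whose
  oscillation is controlled by that of \<open>F\<close>. This replaces product measures, for which the Borel
  sets of a nonmetrizable product space are too large.
\<close>

lemma integral_finite_approx:
  fixes F :: "'a::topological_space \<Rightarrow> 'b::topological_space \<Rightarrow> complex"
  assumes S: "compact S" and K: "compact (UNIV :: 'b set)"
    and F: "continuous_on UNIV (\<lambda>(x, y). F x y)"
    and m: "finite_measure m" "sets m = sets (restrict_space borel S)" and e: "0 < e"
  obtains n :: nat and x c where "\<And>i. i < n \<Longrightarrow> x i \<in> S" "(\<Sum>i<n. c i) = measure m S"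
    "\<And>u :: 'a \<Rightarrow> complex. integrable m u \<Longrightarrow> controlled_by S F e u \<Longrightarrow>
       norm ((\<integral>s. u s \<partial>m) - (\<Sum>i<n. of_real (c i) * u (x i))) \<le> e * measure m S"
proof -
  interpret finite_measure m by (rule m)
  have sp: "space m = S" by (rule space_restrict_borel[OF m(2)])
  have "\<exists>X. open X \<and> s \<in> X \<and> (\<forall>t\<in>X. \<forall>y. norm (F t y - F s y) \<le> e)" for s
  proof -
    have "continuous_on (UNIV \<times> UNIV) (\<lambda>(x, y). F x y)" using F by simp
    then obtain X where "s \<in> X" "open X"
      and X: "\<forall>t\<in>X \<inter> UNIV. \<forall>y\<in>UNIV. dist ((\<lambda>(x, y). F x y) (t, y)) ((\<lambda>(x, y). F x y) (s, y)) \<le> e"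
      by (rule continuous_on_prod_compactE[OF _ K UNIV_I e])
    then show ?thesis by (intro exI[of _ X]) (simp add: dist_norm)
  qed
  then obtain X where X: "\<And>s. open (X s)" "\<And>s. s \<in> X s"
    "\<And>s t y. t \<in> X s \<Longrightarrow> norm (F t y - F s y) \<le> e"
    by metis
  have cover: "S \<subseteq> (\<Union>s\<in>S. X s)" using X(2) by blast
  obtain I where I: "I \<subseteq> S" "finite I" "S \<subseteq> (\<Union>s\<in>I. X s)"
    by (rule compactE_image[OF S X(1) cover])
  obtain x :: "nat \<Rightarrow> 'a" and n where xn: "x ` {..<n} = I"
    using finite_imp_nat_seg_image_inj_on[OF I(2)] by (metis lessThan_def)
  define E where "E i = (X (x i) - (\<Union>j<i. X (x j))) \<inter> S" for i
  have E_sets: "E i \<in> sets m" for i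
    unfolding E_def m(2) sets_restrict_space
    using X(1) by (auto intro!: image_eqI[of _ _ "X (x i) - (\<Union>j<i. X (x j))"] sets.Diff sets.finite_UN)
  have E_disj: "disjoint_family_on E {..<n}"
    unfolding disjoint_family_on_def
  proof (intro ballI impI)
    fix i j :: nat assume "i \<noteq> j"
    then show "E i \<inter> E j = {}" by (cases i j rule: linorder_cases) (auto simp: E_def)
  qed
  have E_cover: "\<exists>i<n. s \<in> E i" if s: "s \<in> S" for s
  proof -
    have "\<exists>i. i < n \<and> s \<in> X (x i)" using s I(3) xn by blast
    then obtain k where k: "k < n" "s \<in> X (x k)" "\<forall>j<k. \<not> (j < n \<and> s \<in> X (x j))"
      unfolding exists_least_iff[of "\<lambda>i. i < n \<and> s \<in> X (x i)"] by blast
    then have "s \<notin> X (x j)" if "j < k" for j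
      using that less_trans[OF that k(1)] by blast
    then have "s \<in> E k" using k(2) s by (simp add: E_def)
    then show ?thesis using k(1) by blast
  qed
  have "E i \<subseteq> S" for i by (auto simp: E_def)
  then have E_union: "(\<Union>i<n. E i) = S" using E_cover by blast
  define c where "c i = measure m (E i)" for i
  show thesis
  proof (rule that[of n x c])
    show "x i \<in> S" if "i < n" for i using that xn I(1) by blast
    show "(\<Sum>i<n. c i) = measure m S"
      unfolding c_def E_union[symmetric] using E_sets E_disj
      by (intro finite_measure_finite_Union[symmetric]) auto
    fix u :: "'a \<Rightarrow> complex"
    assume u: "integrable m u" and ctrl: "controlled_by S F e u"
    define v where "v s = (\<Sum>i<n. indicator (E i) s *\<^sub>R u (x i))" for s
    have int_ind: "integrable m (\<lambda>s. indicator (E i) s *\<^sub>R u (x i))" for i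
      using E_sets[of i] by (intro integrable_scaleR_left integrable_real_indicator)
        (auto simp: emeasure_eq_measure)
    have int_v: "integrable m v"
      unfolding v_def by (intro Bochner_Integration.integrable_sum int_ind)
    have "(\<integral>s. v s \<partial>m) = (\<Sum>i<n. \<integral>s. indicator (E i) s *\<^sub>R u (x i) \<partial>m)"
      unfolding v_def by (intro Bochner_Integration.integral_sum int_ind)
    also have "\<dots> = (\<Sum>i<n. of_real (c i) * u (x i))"
    proof (rule sum.cong)
      fix i
      have "E i \<inter> space m = E i" using sp by (auto simp: E_def)
      then show "(\<integral>s. indicator (E i) s *\<^sub>R u (x i) \<partial>m) = of_real (c i) * u (x i)"
        using E_sets[of i] by (simp add: c_def scaleR_conv_of_real emeasure_eq_measure)
    qed simp
    finally have int_eq: "(\<integral>s. v s \<partial>m) = (\<Sum>i<n. of_real (c i) * u (x i))" .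
    have "norm (u s - v s) \<le> e" if s: "s \<in> S" for s
    proof -
      obtain k where k: "k < n" "s \<in> E k" using E_cover[OF s] by auto
      have "indicator (E i) s *\<^sub>R u (x i) = (if i = k then u (x k) else 0)" if "i < n" for i
        using k E_disj that by (auto simp: disjoint_family_on_def indicator_def)
      then have "v s = (\<Sum>i<n. if i = k then u (x k) else 0)"
        unfolding v_def by (intro sum.cong) auto
      then have "v s = u (x k)" using k by simp
      moreover have "norm (u s - u (x k)) \<le> e"
      proof -
        have "x k \<in> S" using k(1) xn I(1) by blast
        moreover have "norm (F s y - F (x k) y) \<le> e" for y
          using k(2) by (intro X(3)) (simp add: E_def)
        ultimately show ?thesis using ctrl s unfolding controlled_by_def by blast
      qed
      ultimately show ?thesis by simp
    qed
    then have "norm (\<integral>s. u s - v s \<partial>m) \<le> e * measure m (space m)"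
      using u int_v sp by (intro norm_integral_le_const) auto
    then show "norm ((\<integral>s. u s \<partial>m) - (\<Sum>i<n. of_real (c i) * u (x i))) \<le> e * measure m S"
      using u int_v sp by (simp add: int_eq)
  qed
qed

lemma continuous_on_section:
  assumes "continuous_on UNIV (\<lambda>(x, y). F x y)"
  shows "continuous_on UNIV (F x)" "continuous_on UNIV (\<lambda>x. F x y)"
proof -
  have "continuous_on UNIV (\<lambda>y. (\<lambda>(x, y). F x y) (x, y))"
    by (rule continuous_on_compose2[OF assms]) (auto intro!: continuous_intros)
  then show "continuous_on UNIV (F x)" by simp
  have "continuous_on UNIV (\<lambda>x. (\<lambda>(x, y). F x y) (x, y))"
    by (rule continuous_on_compose2[OF assms]) (auto intro!: continuous_intros)
  then show "continuous_on UNIV (\<lambda>x. F x y)" by simp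
qed

lemma integral_mem_subalgebra:
  fixes F :: "'a::topological_space \<Rightarrow> 'b::topological_space \<Rightarrow> complex"
  assumes K: "compact (UNIV :: 'a set)" "compact (UNIV :: 'b set)" and S: "closed S"
    and F: "continuous_on UNIV (\<lambda>(x, y). F x y)" "\<And>x. x \<in> S \<Longrightarrow> F x \<in> A"
    and A: "closed_unital_subalgebra A"
    and m: "finite_measure m" "sets m = sets (restrict_space borel S)"
  shows "(\<lambda>y. \<integral>x. F x y \<partial>m) \<in> A"
proof (rule subalgebra_uniform_approx[OF A])
  fix e :: real assume e: "e > 0"
  define d where "d = e / (measure m S + 1)"
  have m0: "0 \<le> measure m S" by simp
  then have d: "0 < d" using e by (auto simp: d_def intro!: divide_pos_pos add_nonneg_pos)
  have "d * measure m S \<le> d * (measure m S + 1)" using d by simp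
  also have "\<dots> = e" using add_nonneg_pos[OF m0 zero_less_one] by (simp add: d_def)
  finally have de: "d * measure m S \<le> e" .
  have cS: "compact S" using compact_Int_closed[OF K(1) S] by simp
  obtain n :: nat and x c where x: "\<And>i. i < n \<Longrightarrow> x i \<in> S"
    and "(\<Sum>i<n. c i) = measure m S"
    and approx: "\<And>u :: 'a \<Rightarrow> complex. integrable m u \<Longrightarrow> controlled_by S F d u \<Longrightarrow>
       norm ((\<integral>s. u s \<partial>m) - (\<Sum>i<n. of_real (c i) * u (x i))) \<le> d * measure m S"
    by (rule integral_finite_approx[OF cS K(2) F(1) m d]) blast
  show "\<exists>g\<in>A. \<forall>y. norm ((\<integral>x. F x y \<partial>m) - g y) \<le> e"
  proof (intro bexI allI)
    show "(\<lambda>y. \<Sum>i<n. of_real (c i) * F (x i) y) \<in> A"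
      using x F(2) by (intro subalgebra_sum[OF A] subalgebra_scale[OF A]) auto
    fix y
    have "norm ((\<integral>x. F x y \<partial>m) - (\<Sum>i<n. of_real (c i) * F (x i) y)) \<le> d * measure m S"
      by (intro approx controlled_by_section integrable_continuous_compact[OF K(1) m] continuous_on_section[OF F(1)])
    then show "norm ((\<integral>x. F x y \<partial>m) - (\<Sum>i<n. of_real (c i) * F (x i) y)) \<le> e"
      using de by simp
  qed
qed

context
  fixes A :: "('a::t2_space \<Rightarrow> complex) set" and F :: "'a \<Rightarrow> 'a \<Rightarrow> complex"
  assumes K: "compact (UNIV :: 'a set)" and A: "closed_unital_subalgebra A"
    and F: "continuous_on UNIV (\<lambda>(x, y). F x y)"
    and F1: "\<And>x. F x \<in> A" and F2: "\<And>y. (\<lambda>x. F x y) \<in> A"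
begin

lemma spectrum_partial_mem:
  assumes phi: "\<phi> \<in> spectrum A"
  shows "(\<lambda>x. \<phi> (F x)) \<in> A"
proof -
  obtain m where m: "regular_borel_measure_on UNIV m" "emeasure m UNIV = 1"
    "\<And>f. f \<in> A \<Longrightarrow> (\<integral>x. f x \<partial>m) = \<phi> f"
    using spectrum_representing_measure[OF K A phi] by metis
  have "continuous_on UNIV (\<lambda>z. (\<lambda>(x, y). F x y) (snd z, fst z))"
    by (rule continuous_on_compose2[OF F]) (auto intro!: continuous_intros)
  then have "continuous_on UNIV (\<lambda>(y, x). F x y)" by (simp add: case_prod_unfold)
  then have "(\<lambda>x. \<integral>y. F x y \<partial>m) \<in> A"
    using m(1) F2
    by (intro integral_mem_subalgebra[OF K K, of UNIV "\<lambda>y x. F x y"])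
      (auto simp: regular_borel_measure_on_def intro: A)
  then show ?thesis using m(3)[OF F1] by simp
qed

lemma spectrum_Fubini:
  assumes phi: "\<phi> \<in> spectrum A" and psi: "\<psi> \<in> spectrum A" and F3: "(\<lambda>y. \<phi> (\<lambda>x. F x y)) \<in> A"
  shows "\<phi> (\<lambda>x. \<psi> (F x)) = \<psi> (\<lambda>y. \<phi> (\<lambda>x. F x y))"
proof -
  obtain m where m: "regular_borel_measure_on UNIV m" "emeasure m UNIV = 1"
    "\<And>f. f \<in> A \<Longrightarrow> (\<integral>x. f x \<partial>m) = \<phi> f"
    using spectrum_representing_measure[OF K A phi] by metis
  have fm: "finite_measure m" and sm: "sets m = sets (restrict_space borel UNIV)"
    and m1: "measure m UNIV = 1"
    using m(1,2) by (simp_all add: regular_borel_measure_on_def measure_def)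
  have int: "integrable m f" if "f \<in> A" for f
    by (intro integrable_continuous_compact[OF K fm sm] subalgebra_continuous[OF A that])
  have "norm (\<phi> (\<lambda>x. \<psi> (F x)) - \<psi> (\<lambda>y. \<phi> (\<lambda>x. F x y))) \<le> 2 * e" if e: "e > 0" for e
  proof -
    obtain n :: nat and x c where "\<And>i. i < n \<Longrightarrow> x i \<in> UNIV" "(\<Sum>i<n. c i) = measure m UNIV"
      and approx: "\<And>u :: 'a \<Rightarrow> complex. integrable m u \<Longrightarrow> controlled_by UNIV F e u \<Longrightarrow>
         norm ((\<integral>s. u s \<partial>m) - (\<Sum>i<n. of_real (c i) * u (x i))) \<le> e * measure m UNIV"
      by (rule integral_finite_approx[OF K K F fm sm e]) blast
    have "norm ((\<integral>x. \<psi> (F x) \<partial>m) - (\<Sum>i<n. of_real (c i) * \<psi> (F (x i)))) \<le> e * measure m UNIV"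
    proof (rule approx)
      show "integrable m (\<lambda>x. \<psi> (F x))" by (intro int spectrum_partial_mem psi)
      have "norm (\<psi> (F s) - \<psi> (F t)) \<le> e" if "\<forall>y. norm (F s y - F t y) \<le> e" for s t
      proof -
        have "norm (\<psi> (\<lambda>y. F s y - F t y)) \<le> e"
          using that by (intro spectrum_norm_le[OF A psi] subalgebra_diff[OF A] F1) simp
        then show ?thesis by (simp add: spectrum_diff[OF A psi] F1)
      qed
      then show "controlled_by UNIV F e (\<lambda>x. \<psi> (F x))" by (simp add: controlled_by_def)
    qed
    then have 1: "norm (\<phi> (\<lambda>x. \<psi> (F x)) - (\<Sum>i<n. of_real (c i) * \<psi> (F (x i)))) \<le> e"
      by (simp add: m(3) spectrum_partial_mem psi m1)
    have 2: "norm (\<phi> (\<lambda>x. F x y) - (\<Sum>i<n. of_real (c i) * F (x i) y)) \<le> e" for y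
      using approx[OF int[OF F2[of y]] controlled_by_section] by (simp add: m(3)[OF F2] m1)
    have "norm (\<psi> (\<lambda>y. \<phi> (\<lambda>x. F x y) - (\<Sum>i<n. of_real (c i) * F (x i) y))) \<le> e"
      by (intro spectrum_norm_le[OF A psi] subalgebra_diff[OF A] subalgebra_sum[OF A]
          subalgebra_scale[OF A] F1 F3 2)
    then have 3: "norm (\<psi> (\<lambda>y. \<phi> (\<lambda>x. F x y)) - (\<Sum>i<n. of_real (c i) * \<psi> (F (x i)))) \<le> e"
      by (simp add: spectrum_diff[OF A psi] spectrum_sum[OF A psi] spectrum_scale[OF psi]
          subalgebra_sum[OF A] subalgebra_scale[OF A] F1 F3)
    show ?thesis using norm_diff_triangle_le[OF 1, of "\<psi> (\<lambda>y. \<phi> (\<lambda>x. F x y))" e] 3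
      by (simp add: norm_minus_commute)
  qed
  then have "norm (\<phi> (\<lambda>x. \<psi> (F x)) - \<psi> (\<lambda>y. \<phi> (\<lambda>x. F x y))) \<le> 0 + e" if "e > 0" for e
    using that by (metis add_0 field_sum_of_halves half_gt_zero mult_2)
  then have "norm (\<phi> (\<lambda>x. \<psi> (F x)) - \<psi> (\<lambda>y. \<phi> (\<lambda>x. F x y))) \<le> 0"
    by (rule field_le_epsilon)
  then show ?thesis by simp
qed

end

subsection \<open>Invariant algebras and convolution\<close>

lemma invariant_algebra_subalgebra: "invariant_algebra A \<Longrightarrow> closed_unital_subalgebra A"
  and invariant_algebra_left: "invariant_algebra A \<Longrightarrow> f \<in> A \<Longrightarrow> (\<lambda>x. f (g + x)) \<in> A"
  and invariant_algebra_right: "invariant_algebra A \<Longrightarrow> f \<in> A \<Longrightarrow> (\<lambda>x. f (x + g)) \<in> A"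
  by (auto simp: invariant_algebra_def left_translate_def right_translate_def image_subset_iff)

lemma continuous_on_translates:
  fixes f :: "'g::topological_group_add \<Rightarrow> complex"
  assumes "continuous_on UNIV f"
  shows "continuous_on UNIV (\<lambda>(x, y). f (x + y))" "continuous_on UNIV (\<lambda>(x, y). f (y + x))"
    "continuous_on UNIV (\<lambda>(x, y). f (- x + y))"
  unfolding case_prod_unfold
  by (rule continuous_on_compose2[OF assms]; auto intro!: continuous_intros)+

context
  fixes A :: "('g::{topological_group_add, t2_space} \<Rightarrow> complex) set"
  assumes K: "compact (UNIV :: 'g set)" and A: "invariant_algebra A"
begin

lemma right_operator_mem:
  assumes phi: "\<phi> \<in> spectrum A" and f: "f \<in> A"
  shows "right_operator \<phi> f \<in> A"
proof -
  note sub = invariant_algebra_subalgebra[OF A]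
  have "(\<lambda>g. \<phi> ((\<lambda>g h. f (g + h)) g)) \<in> A"
    by (rule spectrum_partial_mem[OF K sub continuous_on_translates(1)[OF subalgebra_continuous[OF sub f]]
          invariant_algebra_left[OF A f] invariant_algebra_right[OF A f] phi])
  then show ?thesis by (simp add: right_operator_def left_translate_def)
qed

lemma left_operator_mem:
  assumes phi: "\<phi> \<in> spectrum A" and f: "f \<in> A"
  shows "(\<lambda>h. \<phi> (\<lambda>g. f (g + h))) \<in> A"
proof -
  note sub = invariant_algebra_subalgebra[OF A]
  have "(\<lambda>h. \<phi> ((\<lambda>h g. f (g + h)) h)) \<in> A"
    by (rule spectrum_partial_mem[OF K sub continuous_on_translates(2)[OF subalgebra_continuous[OF sub f]]
          invariant_algebra_right[OF A f] invariant_algebra_left[OF A f] phi])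
  then show ?thesis by simp
qed

lemma extends_functional_exists:
  assumes phi: "\<phi> \<in> spectrum A"
  shows "\<exists>\<mu>. extends_functional A \<mu> \<phi>"
proof -
  obtain m where m: "regular_borel_measure_on UNIV m" "\<And>f. f \<in> A \<Longrightarrow> (\<integral>x. f x \<partial>m) = \<phi> f"
    using spectrum_representing_measure[OF K invariant_algebra_subalgebra[OF A] phi] by metis
  then have "extends_functional A (m, \<lambda>x. 1) \<phi>"
    by (simp add: extends_functional_def complex_regular_borel_measure_def complex_integral_def)
  then show ?thesis by blast
qed

lemma convolution_eq:
  assumes phi: "\<phi> \<in> spectrum A" and psi: "\<psi> \<in> spectrum A"
  shows "convolution A \<phi> \<psi> = (\<lambda>f\<in>A. \<psi> (\<lambda>h. \<phi> (\<lambda>g. f (g + h))))"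
proof -
  have eq: "(\<lambda>f\<in>A. complex_integral \<nu> (\<lambda>h. complex_integral \<mu> (\<lambda>g. f (g + h))))
      = (\<lambda>f\<in>A. \<psi> (\<lambda>h. \<phi> (\<lambda>g. f (g + h))))"
    if "extends_functional A \<mu> \<phi>" "extends_functional A \<nu> \<psi>" for \<mu> \<nu>
  proof (rule restrict_ext)
    fix f assume f: "f \<in> A"
    have "complex_integral \<mu> (\<lambda>g. f (g + h)) = \<phi> (\<lambda>g. f (g + h))" for h
      using that(1) invariant_algebra_right[OF A f] by (simp add: extends_functional_def)
    then show "complex_integral \<nu> (\<lambda>h. complex_integral \<mu> (\<lambda>g. f (g + h)))
        = \<psi> (\<lambda>h. \<phi> (\<lambda>g. f (g + h)))"
      using that(2) left_operator_mem[OF phi f] by (simp add: extends_functional_def)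
  qed
  show ?thesis
    unfolding convolution_def
  proof (rule the_equality)
    obtain \<mu> \<nu> where "extends_functional A \<mu> \<phi>" "extends_functional A \<nu> \<psi>"
      using extends_functional_exists[OF phi] extends_functional_exists[OF psi] by blast
    then show "\<exists>\<mu> \<nu>. extends_functional A \<mu> \<phi> \<and> extends_functional A \<nu> \<psi> \<and>
        (\<lambda>f\<in>A. \<psi> (\<lambda>h. \<phi> (\<lambda>g. f (g + h)))) =
        (\<lambda>f\<in>A. complex_integral \<nu> (\<lambda>h. complex_integral \<mu> (\<lambda>g. f (g + h))))"
      using eq by metis
  qed (use eq in auto)
qed

lemma right_operator_convolution:
  assumes phi: "\<phi> \<in> spectrum A" and psi: "\<psi> \<in> spectrum A" and f: "f \<in> A"
  shows "right_operator (convolution A \<phi> \<psi>) f = right_operator \<phi> (right_operator \<psi> f)"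
proof
  fix g
  let ?f = "\<lambda>x. f (g + x)"
  note sub = invariant_algebra_subalgebra[OF A]
  have fA: "?f \<in> A" by (rule invariant_algebra_left[OF A f])
  have "right_operator (convolution A \<phi> \<psi>) f g = \<psi> (\<lambda>y. \<phi> (\<lambda>x. ?f (x + y)))"
    using fA by (simp add: right_operator_def left_translate_def convolution_eq[OF phi psi])
  also have "\<dots> = \<phi> (\<lambda>x. \<psi> (\<lambda>y. ?f (x + y)))"
    by (rule spectrum_Fubini[OF K sub continuous_on_translates(1)[OF subalgebra_continuous[OF sub fA]]
          invariant_algebra_left[OF A fA] invariant_algebra_right[OF A fA] phi psi
          left_operator_mem[OF phi fA], symmetric])
  also have "\<dots> = right_operator \<phi> (right_operator \<psi> f) g"
    by (simp add: right_operator_def left_translate_def add.assoc)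
  finally show "right_operator (convolution A \<phi> \<psi>) f g = right_operator \<phi> (right_operator \<psi> f) g" .
qed

end

subsection \<open>Averaging over a subgroup\<close>

context
  fixes H :: "'g::{topological_group_add, t2_space} set" and m :: "'g measure"
  assumes K: "compact (UNIV :: 'g set)" and H: "closed_subgroup H"
    and haar: "normalized_haar_measure H m"
begin

lemma
  shows haar_finite: "finite_measure m" and haar_sets: "sets m = sets (restrict_space borel H)"
    and haar_space: "space m = H" and haar_measure_1: "measure m H = 1"
  using haar space_restrict_borel[of m H]
  by (auto simp: normalized_haar_measure_def regular_borel_measure_on_def measure_def)

lemma haar_integrable:
  fixes u :: "'g \<Rightarrow> complex"
  shows "continuous_on UNIV u \<Longrightarrow> integrable m u"
  by (rule integrable_continuous_compact[OF K haar_finite haar_sets])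

lemma haar_integral_left:
  fixes u :: "'g \<Rightarrow> complex"
  assumes u: "continuous_on UNIV u" and h: "h \<in> H"
  shows "(\<integral>x. u (h + x) \<partial>m) = (\<integral>x. u x \<partial>m)"
proof -
  have hH: "h + x \<in> H" "- h + x \<in> H" if "x \<in> H" for x
    using H h that by (auto simp: closed_subgroup_def)
  have T: "(\<lambda>x. h + x) \<in> measurable m m"
  proof -
    have "(\<lambda>x. h + x) \<in> borel_measurable borel"
      by (intro borel_measurable_continuous_onI continuous_intros)
    then have "(\<lambda>x. h + x) \<in> measurable m borel"
      by (rule borel_measurable_restrict_borel[OF haar_sets])
    then have "(\<lambda>x. h + x) \<in> measurable m (restrict_space borel H)"
      using hH by (intro measurable_restrict_space2) (auto simp: haar_space)
    then show ?thesis by (simp add: measurable_cong_sets[OF refl haar_sets])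
  qed
  have "distr m m (\<lambda>x. h + x) = m"
  proof (rule measure_eqI)
    fix E assume "E \<in> sets (distr m m (\<lambda>x. h + x))"
    then have E: "E \<in> sets m" by simp
    then have EH: "E \<subseteq> H" using sets.sets_into_space haar_space by blast
    have "(\<lambda>x. h + x) -` E \<inter> space m = (\<lambda>x. - h + x) ` E"
    proof (intro set_eqI iffI)
      fix x assume "x \<in> (\<lambda>x. h + x) -` E \<inter> space m"
      then show "x \<in> (\<lambda>x. - h + x) ` E"
        by (intro image_eqI[of _ _ "h + x"]) (auto simp: add.assoc[symmetric])
    next
      fix x assume "x \<in> (\<lambda>x. - h + x) ` E"
      then show "x \<in> (\<lambda>x. h + x) -` E \<inter> space m"
        using EH hH by (auto simp: add.assoc[symmetric] haar_space)
    qed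
    then show "emeasure (distr m m (\<lambda>x. h + x)) E = emeasure m E"
      using haar E h H T
      by (simp add: emeasure_distr normalized_haar_measure_def closed_subgroup_def)
  qed simp
  then have "(\<integral>x. u x \<partial>m) = (\<integral>x. u x \<partial>distr m m (\<lambda>x. h + x))" by simp
  also have "\<dots> = (\<integral>x. u (h + x) \<partial>m)"
    using borel_measurable_integrable[OF haar_integrable[OF u]] T by (rule integral_distr[rotated])
  finally show ?thesis by simp
qed

lemma haar_integral_reflect:
  fixes u :: "'g \<Rightarrow> complex"
  assumes u: "continuous_on UNIV u" and y: "y \<in> H"
  shows "(\<integral>x. u (- x + y) \<partial>m) = (\<integral>x. u (- x) \<partial>m)"
proof -
  have "continuous_on UNIV (\<lambda>z. u (- z + y))"
    by (rule continuous_on_compose2[OF u]) (auto intro!: continuous_intros)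
  from haar_integral_left[OF this y] show ?thesis
    by (simp add: minus_add add.assoc)
qed

text \<open>
  The integral of \<open>u (- x + y)\<close> over \<open>H \<times> H\<close> is computed in both orders: by left invariance,
  integrating over \<open>y\<close> first gives the integral of \<open>u\<close>, and integrating over \<open>x\<close> first gives
  the integral of \<open>u (- x)\<close>.
\<close>

lemma haar_integral_inverse:
  fixes u :: "'g \<Rightarrow> complex"
  assumes u: "continuous_on UNIV u"
  shows "(\<integral>x. u (- x) \<partial>m) = (\<integral>x. u x \<partial>m)"
proof -
  have cH: "compact H"
    using compact_Int_closed[OF K, of H] H by (simp add: closed_subgroup_def)
  let ?F = "\<lambda>x y. u (- x + y)"
  have F: "continuous_on UNIV (\<lambda>(x, y). ?F x y)" by (rule continuous_on_translates(3)[OF u])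
  have "norm ((\<integral>x. u (- x) \<partial>m) - (\<integral>x. u x \<partial>m)) \<le> 0 + e" if e: "e > 0" for e
  proof -
    obtain n :: nat and x c where x: "\<And>i. i < n \<Longrightarrow> x i \<in> H" "(\<Sum>i<n. c i) = measure m H"
      and approx: "\<And>v :: 'g \<Rightarrow> complex. integrable m v \<Longrightarrow> controlled_by H ?F e v \<Longrightarrow>
         norm ((\<integral>s. v s \<partial>m) - (\<Sum>i<n. of_real (c i) * v (x i))) \<le> e * measure m H"
      by (rule integral_finite_approx[OF cH K F haar_finite haar_sets e]) blast
    have bound: "norm ((\<integral>s. u (- s) \<partial>m) - (\<Sum>i<n. of_real (c i) * ?F (x i) y)) \<le> e"
      if "y \<in> H" for y
      using approx[OF haar_integrable[OF continuous_on_section(2)[OF F, of y]] controlled_by_section]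
        haar_integral_reflect[OF u that] haar_measure_1 by simp
    have intF: "integrable m (\<lambda>y. of_real (c i) * ?F (x i) y)" for i
      by (intro integrable_mult_right haar_integrable continuous_on_section(1)[OF F, of "x i"])
    have intc: "integrable m (\<lambda>y. \<integral>s. u (- s) \<partial>m)"
      by (rule haar_integrable) simp
    have "(\<integral>y. (\<Sum>i<n. of_real (c i) * ?F (x i) y) \<partial>m) = (\<Sum>i<n. of_real (c i) * (\<integral>y. u y \<partial>m))"
    proof (subst Bochner_Integration.integral_sum[OF intF], rule sum.cong)
      fix i assume "i \<in> {..<n}"
      then have "- x i \<in> H" using x(1) H by (auto simp: closed_subgroup_def)
      then show "(\<integral>y. of_real (c i) * ?F (x i) y \<partial>m) = of_real (c i) * (\<integral>y. u y \<partial>m)"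
        using haar_integral_left[OF u] by simp
    qed simp
    also have "\<dots> = (\<integral>y. u y \<partial>m)"
      using x(2) haar_measure_1 by (simp flip: sum_distrib_right of_real_sum)
    finally have "(\<integral>y. (\<integral>s. u (- s) \<partial>m) - (\<Sum>i<n. of_real (c i) * ?F (x i) y) \<partial>m)
        = (\<integral>x. u (- x) \<partial>m) - (\<integral>x. u x \<partial>m)"
      by (subst Bochner_Integration.integral_diff[OF intc Bochner_Integration.integrable_sum[OF intF]])
        (simp add: haar_space haar_measure_1)
    moreover have "norm (\<integral>y. (\<integral>s. u (- s) \<partial>m) - (\<Sum>i<n. of_real (c i) * ?F (x i) y) \<partial>m)
        \<le> e * measure m (space m)"
      using bound haar_space
      by (intro finite_measure.norm_integral_le_const[OF haar_finite]
          Bochner_Integration.integrable_diff intc Bochner_Integration.integrable_sum intF) auto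
    ultimately show ?thesis by (simp add: haar_space haar_measure_1)
  qed
  then have "norm ((\<integral>x. u (- x) \<partial>m) - (\<integral>x. u x \<partial>m)) \<le> 0" by (rule field_le_epsilon)
  then show ?thesis by simp
qed

lemma haar_integral_right:
  fixes u :: "'g \<Rightarrow> complex"
  assumes u: "continuous_on UNIV u" and h: "h \<in> H"
  shows "(\<integral>x. u (x + h) \<partial>m) = (\<integral>x. u x \<partial>m)"
proof -
  have "continuous_on UNIV (\<lambda>x. u (x + h))"
    by (rule continuous_on_compose2[OF u]) (auto intro!: continuous_intros)
  from haar_integral_inverse[OF this] show ?thesis
    using haar_integral_reflect[OF u h] haar_integral_inverse[OF u] by simp
qed

context
  fixes A :: "('g \<Rightarrow> complex) set"
  assumes A: "invariant_algebra A"
begin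

lemma left_average_image: "left_average m ` A = {f\<in>A. \<forall>h\<in>H. \<forall>x. f (h + x) = f x}"
proof (intro set_eqI iffI)
  fix f assume "f \<in> left_average m ` A"
  then obtain a where a: "a \<in> A" and f: "f = (\<lambda>g. \<integral>h. a (h + g) \<partial>m)"
    by (auto simp: left_average_def left_translate_def)
  have ca: "continuous_on UNIV a"
    by (rule subalgebra_continuous[OF invariant_algebra_subalgebra[OF A] a])
  have "f \<in> A"
    unfolding f using H
    by (intro integral_mem_subalgebra[OF K K _ continuous_on_translates(1)[OF ca] _
          invariant_algebra_subalgebra[OF A] haar_finite haar_sets] invariant_algebra_left[OF A a])
      (simp add: closed_subgroup_def)
  moreover have "f (h + x) = f x" if "h \<in> H" for h x
  proof -
    have "continuous_on UNIV (\<lambda>z. a (z + x))"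
      by (rule continuous_on_compose2[OF ca]) (auto intro!: continuous_intros)
    from haar_integral_right[OF this that] show ?thesis by (simp add: f add.assoc)
  qed
  ultimately show "f \<in> {f\<in>A. \<forall>h\<in>H. \<forall>x. f (h + x) = f x}" by blast
next
  fix f assume f: "f \<in> {f\<in>A. \<forall>h\<in>H. \<forall>x. f (h + x) = f x}"
  have "(\<integral>h. f (h + g) \<partial>m) = (\<integral>h. f g \<partial>m)" for g
    using f haar_space by (intro Bochner_Integration.integral_cong) auto
  then have "left_average m f = f"
    by (simp add: left_average_def left_translate_def haar_space haar_measure_1 fun_eq_iff)
  then show "f \<in> left_average m ` A" using f by force
qed

lemma closed_unital_subalgebra_left_average: "closed_unital_subalgebra (left_average m ` A)"
proof -
  note sub = invariant_algebra_subalgebra[OF A]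
  have lim: "f (h + x) = f x"
    if F: "\<And>n. F n \<in> left_average m ` A" "uniform_limit UNIV F f sequentially" "h \<in> H" for F f h x
  proof -
    have lim: "(\<lambda>n. F n y) \<longlonglongrightarrow> f y" for y
      using tendsto_uniform_limitI[OF F(2)] by simp
    have "F n (h + x) = F n x" for n
      using F(1)[of n] F(3) by (simp add: left_average_image)
    then show ?thesis using LIMSEQ_unique[OF lim[of "h + x"], of "f x"] lim[of x] by simp
  qed
  show ?thesis
    unfolding closed_unital_subalgebra_def
  proof (intro conjI ballI allI impI)
    fix F f assume F: "(\<forall>n. F n \<in> left_average m ` A) \<and> uniform_limit UNIV F f sequentially"
    then have "f \<in> A"
      by (intro subalgebra_uniform_limit[OF sub, of F f]) (auto simp: left_average_image)
    then show "f \<in> left_average m ` A"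
      using F lim[of F f] by (simp add: left_average_image)
  qed (auto simp: left_average_image intro: subalgebra_continuous[OF sub] subalgebra_const[OF sub]
      subalgebra_add[OF sub] subalgebra_mult[OF sub] subalgebra_scale[OF sub])
qed

lemma spectrum_left_average_extend:
  assumes psi: "\<psi> \<in> spectrum (left_average m ` A)"
  obtains \<tau> where "\<tau> \<in> spectrum A" "\<And>f. f \<in> left_average m ` A \<Longrightarrow> \<tau> f = \<psi> f"
proof (rule spectrum_extend_of_projection[OF K invariant_algebra_subalgebra[OF A]
      closed_unital_subalgebra_left_average _ _ _ _ _ psi])
  note sub = invariant_algebra_subalgebra[OF A]
  show "left_average m ` A \<subseteq> A" unfolding left_average_image by blast
  show "left_average m f \<in> left_average m ` A" if "f \<in> A" for f using that by blast
  show "left_average m (\<lambda>x. 1) = (\<lambda>x. 1)"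
    by (simp add: left_average_def left_translate_def haar_space haar_measure_1)
  have int: "integrable m (\<lambda>h. f (h + g))" if "f \<in> A" for f g
    by (intro haar_integrable subalgebra_continuous[OF sub] invariant_algebra_right[OF A that])
  show "left_average m (\<lambda>x. f x + g x) = (\<lambda>x. left_average m f x + left_average m g x)"
    if "f \<in> A" "g \<in> A" for f g
    using int[OF that(1)] int[OF that(2)] by (simp add: left_average_def left_translate_def)
  show "left_average m (\<lambda>x. b x * f x) = (\<lambda>x. b x * left_average m f x)"
    if b: "b \<in> left_average m ` A" and f: "f \<in> A" for b f
  proof
    fix g
    have "(\<integral>h. b (h + g) * f (h + g) \<partial>m) = (\<integral>h. b g * f (h + g) \<partial>m)"
      using b haar_space unfolding left_average_image
      by (intro Bochner_Integration.integral_cong) auto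
    then show "left_average m (\<lambda>x. b x * f x) g = b g * left_average m f g"
      by (simp add: left_average_def left_translate_def)
  qed
qed (rule that)

end

end

subsection \<open>The action\<close>

theorem theorem4:
  fixes A :: "('g::{topological_group_add, t2_space} \<Rightarrow> complex) set"
    and H :: "'g set" and dh :: "'g measure" and M :: "'g set set"
    and AH :: "('g \<Rightarrow> complex) set"
  assumes "compact (UNIV :: 'g set)"
    and "invariant_algebra A"
    and "closed_subgroup H"
    and "normalized_haar_measure H dh"
    and "M = right_cosets H"
    and "AH = left_average dh ` A"
  shows "(\<forall>\<phi>\<in>spectrum A. \<forall>f\<in>AH. right_operator \<phi> f \<in> AH) \<and>
    right_semigroup_action (spectrum A) (convolution A) (evaluation A 0)
      (spectrum AH) (spectrum_action AH) \<and>
    (\<forall>p\<in>M. coset_evaluation AH p \<in> spectrum AH) \<and>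
    (\<forall>p\<in>M. \<forall>g. spectrum_action AH (coset_evaluation AH p) (evaluation A g) =
       coset_evaluation AH (coset_translate p g)) \<and>
    (\<forall>p\<in>M. spectrum_action AH (coset_evaluation AH p) ` spectrum A = spectrum AH)"
proof -
  note K = assms(1) and A = assms(2) and H = assms(3) and haar = assms(4) and M = assms(5)
  note sub = invariant_algebra_subalgebra[OF A]
  have AH: "AH = {f\<in>A. \<forall>h\<in>H. \<forall>x. f (h + x) = f x}"
    using left_average_image[OF K H haar A] assms(6) by simp
  have subH: "closed_unital_subalgebra AH"
    using closed_unital_subalgebra_left_average[OF K H haar A] assms(6) by simp
  have AH_A: "f \<in> A" if "f \<in> AH" for f using that AH by blast
  have left: "(\<lambda>x. f (g + x)) \<in> A" if "f \<in> AH" for f g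
    by (rule invariant_algebra_left[OF A AH_A[OF that]])
  have rop: "right_operator \<phi> f \<in> AH" if "\<phi> \<in> spectrum A" "f \<in> AH" for \<phi> f
    using right_operator_mem[OF K A that(1) AH_A[OF that(2)]] that(2)
    by (auto simp: AH right_operator_def left_translate_def add.assoc)
  have act_mem: "spectrum_action AH \<psi> \<phi> \<in> spectrum AH"
    if psi: "\<psi> \<in> spectrum AH" and phi: "\<phi> \<in> spectrum A" for \<psi> \<phi>
    unfolding spectrum_def
  proof (intro CollectI conjI ballI allI)
    show "spectrum_action AH \<psi> \<phi> \<in> extensional AH" by (simp add: spectrum_action_def)
    have "right_operator \<phi> (\<lambda>x. 1) = (\<lambda>x. 1)"
      by (simp add: right_operator_def left_translate_def spectrum_const[OF sub phi])
    then show "\<exists>f\<in>AH. spectrum_action AH \<psi> \<phi> f \<noteq> 0"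
      using subalgebra_const[OF subH, of 1] spectrum_const[OF subH psi, of 1]
      by (intro bexI[of _ "\<lambda>x. 1"]) (auto simp: spectrum_action_def)
  next
    fix c f assume f: "f \<in> AH"
    have "right_operator \<phi> (\<lambda>x. c * f x) = (\<lambda>x. c * right_operator \<phi> f x)"
      by (simp add: right_operator_def left_translate_def spectrum_scale[OF phi] left[OF f])
    then show "spectrum_action AH \<psi> \<phi> (\<lambda>x. c * f x) = c * spectrum_action AH \<psi> \<phi> f"
      using f rop[OF phi f]
      by (simp add: spectrum_action_def spectrum_scale[OF psi] subalgebra_scale[OF subH])
  next
    fix f g assume f: "f \<in> AH" and g: "g \<in> AH"
    have "right_operator \<phi> (\<lambda>x. f x + g x) = (\<lambda>x. right_operator \<phi> f x + right_operator \<phi> g x)"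
      by (simp add: right_operator_def left_translate_def spectrum_add[OF phi] left f g)
    then show "spectrum_action AH \<psi> \<phi> (\<lambda>x. f x + g x) =
        spectrum_action AH \<psi> \<phi> f + spectrum_action AH \<psi> \<phi> g"
      using f g rop[OF phi f] rop[OF phi g]
      by (simp add: spectrum_action_def spectrum_add[OF psi] subalgebra_add[OF subH])
    have "right_operator \<phi> (\<lambda>x. f x * g x) = (\<lambda>x. right_operator \<phi> f x * right_operator \<phi> g x)"
      by (simp add: right_operator_def left_translate_def spectrum_mult[OF phi] left f g)
    then show "spectrum_action AH \<psi> \<phi> (\<lambda>x. f x * g x) =
        spectrum_action AH \<psi> \<phi> f * spectrum_action AH \<psi> \<phi> g"
      using f g rop[OF phi f] rop[OF phi g]
      by (simp add: spectrum_action_def spectrum_mult[OF psi] subalgebra_mult[OF subH])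
  qed
  have eval: "right_operator (evaluation A g) f = (\<lambda>x. f (x + g))" if "f \<in> AH" for f g
    using left[OF that] by (simp add: right_operator_def left_translate_def evaluation_def)
  have "right_semigroup_action (spectrum A) (convolution A) (evaluation A 0)
      (spectrum AH) (spectrum_action AH)"
    unfolding right_semigroup_action_def
  proof (intro conjI ballI)
    fix \<psi> \<phi> assume "\<psi> \<in> spectrum AH" "\<phi> \<in> spectrum A"
    then show "spectrum_action AH \<psi> \<phi> \<in> spectrum AH" by (rule act_mem)
  next
    fix \<psi> s t assume st: "s \<in> spectrum A" "t \<in> spectrum A"
    show "spectrum_action AH (spectrum_action AH \<psi> s) t = spectrum_action AH \<psi> (convolution A s t)"
      unfolding spectrum_action_def
      by (rule restrict_ext)
        (simp add: right_operator_convolution[OF K A st AH_A] rop[OF st(2)])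
  next
    fix \<psi> assume psi: "\<psi> \<in> spectrum AH"
    have "spectrum_action AH \<psi> (evaluation A 0) = restrict \<psi> AH"
      unfolding spectrum_action_def by (rule restrict_ext) (simp add: eval)
    then show "spectrum_action AH \<psi> (evaluation A 0) = \<psi>"
      using extensional_restrict[OF spectrum_extensional[OF psi]] by simp
  qed
  moreover have coset_ev: "coset_evaluation AH ((\<lambda>h. h + g) ` H) = (\<lambda>f\<in>AH. f g)" for g
    unfolding coset_evaluation_def
  proof (rule restrict_ext)
    fix f assume f: "f \<in> AH"
    have "0 \<in> H" using H by (simp add: closed_subgroup_def)
    then have "f ` (\<lambda>h. h + g) ` H = {f g}" using f unfolding AH by force
    then show "the_elem (f ` (\<lambda>h. h + g) ` H) = f g" by simp
  qed
  moreover have point: "(\<lambda>f\<in>AH. f g) \<in> spectrum AH" for g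
    using subalgebra_const[OF subH, of 1] subalgebra_add[OF subH] subalgebra_mult[OF subH]
      subalgebra_scale[OF subH]
    by (auto simp: spectrum_def intro!: bexI[of _ "\<lambda>x. 1"])
  moreover have "spectrum_action AH (coset_evaluation AH p) (evaluation A g) =
       coset_evaluation AH (coset_translate p g)" if p: "p \<in> M" for p g
  proof -
    obtain k where k: "p = (\<lambda>h. h + k) ` H" using p M by (auto simp: right_cosets_def)
    then have "coset_translate p g = (\<lambda>h. h + (k + g)) ` H"
      by (auto simp: coset_translate_def image_image add.assoc)
    moreover have "(\<lambda>x. f (x + g)) \<in> AH" if "f \<in> AH" for f
      using that invariant_algebra_right[OF A AH_A[OF that]] by (auto simp: AH add.assoc)
    ultimately show ?thesis
      unfolding spectrum_action_def k coset_ev by (simp add: coset_ev eval cong: restrict_cong)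
  qed
  moreover have "spectrum_action AH (coset_evaluation AH p) ` spectrum A = spectrum AH"
    if p: "p \<in> M" for p
  proof (intro antisym subsetI)
    obtain k where k: "p = (\<lambda>h. h + k) ` H" using p M by (auto simp: right_cosets_def)
    fix \<psi>
    show "\<psi> \<in> spectrum AH" if "\<psi> \<in> spectrum_action AH (coset_evaluation AH p) ` spectrum A"
      using that point act_mem by (auto simp: k coset_ev)
    assume psi: "\<psi> \<in> spectrum AH"
    then obtain \<tau> where tau: "\<tau> \<in> spectrum A" "\<And>f. f \<in> AH \<Longrightarrow> \<tau> f = \<psi> f"
      using spectrum_left_average_extend[OF K H haar A, of \<psi>] assms(6) by metis
    define \<phi> where "\<phi> = (\<lambda>f\<in>A. \<tau> (\<lambda>x. f (- k + x)))"
    have phi: "\<phi> \<in> spectrum A"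
      unfolding spectrum_def
    proof (intro CollectI conjI ballI allI)
      show "\<exists>f\<in>A. \<phi> f \<noteq> 0"
        using subalgebra_const[OF sub, of 1] spectrum_const[OF sub tau(1), of 1]
        by (intro bexI[of _ "\<lambda>x. 1"]) (auto simp: \<phi>_def)
    qed (simp_all add: \<phi>_def subalgebra_add[OF sub] subalgebra_mult[OF sub] subalgebra_scale[OF sub]
        invariant_algebra_left[OF A] spectrum_add[OF tau(1)] spectrum_mult[OF tau(1)]
        spectrum_scale[OF tau(1)])
    have "spectrum_action AH (coset_evaluation AH p) \<phi> f = \<psi> f" for f
    proof (cases "f \<in> AH")
      case True
      then show ?thesis
        using rop[OF phi True] left[OF True, of k] tau(2)[OF True]
        by (simp add: spectrum_action_def k coset_ev right_operator_def left_translate_def \<phi>_def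
            add.assoc[symmetric])
    next
      case False
      then show ?thesis
        using spectrum_extensional[OF psi] by (simp add: spectrum_action_def extensional_def)
    qed
    then have "\<psi> = spectrum_action AH (coset_evaluation AH p) \<phi>" by (simp add: fun_eq_iff)
    then show "\<psi> \<in> spectrum_action AH (coset_evaluation AH p) ` spectrum A" using phi by blast
  qed
  ultimately show ?thesis
    using rop M by (auto simp: right_cosets_def)
qed

end
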